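(* Let $\{Z_t\}_{t\ge 0}$ be a theta-positive branching process in varying environment with parameters $(\theta,\{\lambda_t\},\{a_t\})$, where $\theta\in(0,1]$. The process is critical if and only if $V_\theta=\infty$ and $\mu_t^{\theta}V_{t,\theta}\to\infty$ as $t\to\infty$. In this case, as $t\to\infty$, $$\mathrm{P}(Z_t>0)\sim V_{t,\theta}^{-1/\theta},\qquad m_t\sim\mu_tV_{t,\theta}^{1/\theta},$$ and $$\lim_{t\to\infty}\mathrm{E}\big(e^{-wZ_t/m_t}\mid Z_t>0\big)=1-(1+w^{-\theta})^{-1/\theta},\qquad w\ge0$$ (the right-hand side being read as $1$ for $w=0$).
   Context: Theta-positive branching process in varying environment with parameters $(\theta,\{\lambda_t\},\{a_t\})$: fix $\theta\in(0,1]$ and measurable functions $t\mapsto\lambda_t\ge0$ and $t\mapsto a_t$ on $[0,\infty)$ such that $\Lambda_t=\int_0^t\lambda_u\,du<\infty$ for all $t\ge0$ and $0\le a_t\le 1+1/\theta$ for all $t\ge 0$. The process $\{Z_t\}_{t\ge0}$ is the time-inhomogeneous continuous-time Markov branching process on $\{0,1,2,\dots\}$ with $Z_0=1$ (right-continuous sample paths) in which individuals live and reproduce independently; an individual alive at time $t$ dies during $(t,t+\delta)$ with probability $\lambda_t\delta+o(\delta)$ as $\delta\to0$, and an individual dying at time $t$ is instantaneously replaced by $k$ offspring with probability $p_t(k)$, where $k=0$ or $k\ge2$. (So from state $n$ the process jumps to $n-1+k$ at rate $n\lambda_tp_t(k)$ at time $t$.) The offspring probability generating function is $h_t(s)=p_t(0)+\sum_{k\ge2}p_t(k)s^k=1-a_t(1-s)+a_t(1+\theta)^{-1}(1-s)^{1+\theta}$,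 $0\le s\le 1$; in particular $a_t=\sum_{k\ge 2} kp_t(k)$ is the mean offspring number. Notation: $\mu_t=\mathrm{E}(Z_t)=\exp\{\int_0^t(a_u-1)\,d\Lambda_u\}$, where $d\Lambda_u=\lambda_u\,du$; $m_t=\mathrm{E}(Z_t\mid Z_t>0)$; $q=\lim_{t\to\infty}\mathrm{P}(Z_t=0)$ is the extinction probability; $V_{t,\theta}=\theta(1+\theta)^{-1}\int_0^t\mu_u^{-\theta}\,d\Lambda_u$; $V_\theta=\lim_{t\to\infty}V_{t,\theta}\in[0,\infty]$. Here $f(t)\sim g(t)$ means $f(t)/g(t)\to1$. The process is called critical if $q=1$ and $\lim_{t\to\infty}m_t=\infty$. *)

theory Defs
  imports "HOL-Probability.Probability" "HOL-Library.Landau_Symbols"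
begin

definition cum_rate :: "(real \<Rightarrow> real) \<Rightarrow> real \<Rightarrow> real" where
  "cum_rate lam t = (LBINT u:{0..t}. lam u)"

text \<open>
  The offspring law at time \<open>t\<close> is \<open>p t\<close>. The equation for its generating function determines
  \<open>p t\<close> for \<open>t \<ge> 0\<close>, so \<open>p\<close> is not a further degree of freedom; in particular
  \<open>t \<mapsto> pmf (p t) k\<close> is measurable because \<open>a\<close> is.
\<close>

locale theta_positive_environment =
  fixes \<theta> :: real and lam a :: "real \<Rightarrow> real" and p :: "real \<Rightarrow> nat pmf"
  assumes theta_pos: "0 < \<theta>" and theta_le_1: "\<theta> \<le> 1"
    and lam_measurable: "set_borel_measurable lborel {0..} lam"
    and a_measurable: "set_borel_measurable lborel {0..} a"
    and lam_nonneg: "\<And>t. 0 \<le> t \<Longrightarrow> 0 \<le> lam t"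
    and lam_integrable: "\<And>t. 0 \<le> t \<Longrightarrow> set_integrable lborel {0..t} lam"
    and a_nonneg: "\<And>t. 0 \<le> t \<Longrightarrow> 0 \<le> a t"
    and a_upper: "\<And>t. 0 \<le> t \<Longrightarrow> a t \<le> 1 + 1 / \<theta>"
    and no_single_offspring: "\<And>t. 0 \<le> t \<Longrightarrow> pmf (p t) 1 = 0"
    and offspring_pgf: "\<And>t s. \<lbrakk>0 \<le> t; 0 \<le> s; s \<le> 1\<rbrakk> \<Longrightarrow>
          (\<Sum>k. pmf (p t) k * s ^ k)
            = 1 - a t * (1 - s) + a t / (1 + \<theta>) * (1 - s) powr (1 + \<theta>)"

text \<open>
  \<open>K s t n\<close> is the law of the population size at time \<open>t\<close> given that it is \<open>n\<close> at time \<open>s\<close>.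
  Independence of the individuals is the assumption \<open>branching\<close>: \<open>K s t n\<close> is the law of the sum
  of \<open>n\<close> independent variables with law \<open>K s t 1\<close>.

  The assumptions \<open>no_death\<close> and \<open>death\<close> say what becomes of one individual in a short
  interval \<open>(s, t]\<close>. It survives with probability
  \<open>1 - (cum_rate lam t - cum_rate lam s) + o(cum_rate lam t - cum_rate lam s)\<close>, and it dies
  leaving \<open>j\<close> offspring with probability
  \<open>(LBINT u:{s..t}. lam u * pmf (p u) j) + o(cum_rate lam t - cum_rate lam s)\<close>. Since \<open>lam\<close>
  is only measurable and locally integrable, \<open>lam s * \<delta>\<close> is written in integrated form: a
  condition at individual times could hold only almost everywhere and would say nothing about
  changes of the population on a null set of times. For the same reason the error is
  uniform on compact time intervals: with separate one-sided limits at each \<open>s\<close>, jumps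
  at deterministic times would not be excluded.
\<close>

locale theta_positive_bpve =
  prob_space M + theta_positive_environment \<theta> lam a p
  for M :: "'w measure" and \<theta> :: real and lam a :: "real \<Rightarrow> real" and p :: "real \<Rightarrow> nat pmf" +
  fixes K :: "real \<Rightarrow> real \<Rightarrow> nat \<Rightarrow> nat pmf" and Z :: "real \<Rightarrow> 'w \<Rightarrow> nat"
  assumes Z_measurable: "\<And>t. 0 \<le> t \<Longrightarrow> Z t \<in> M \<rightarrow>\<^sub>M count_space UNIV"
    and Z_0: "AE \<omega> in M. Z 0 \<omega> = 1"
    and right_continuous: "AE \<omega> in M. \<forall>t\<ge>0. continuous (at_right t) (\<lambda>u. Z u \<omega>)"
    and markov: "\<And>(n::nat) (t::nat \<Rightarrow> real) (i::nat \<Rightarrow> nat).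
          \<lbrakk>0 \<le> t 0; \<And>k. k \<le> n \<Longrightarrow> t k \<le> t (Suc k)\<rbrakk> \<Longrightarrow>
          prob {\<omega> \<in> space M. \<forall>k\<le>Suc n. Z (t k) \<omega> = i k}
            = prob {\<omega> \<in> space M. \<forall>k\<le>n. Z (t k) \<omega> = i k}
              * pmf (K (t n) (t (Suc n)) (i n)) (i (Suc n))"
    and transition_refl: "\<And>s n. 0 \<le> s \<Longrightarrow> K s s n = return_pmf n"
    and chapman_kolmogorov: "\<And>s t u n. \<lbrakk>0 \<le> s; s \<le> t; t \<le> u\<rbrakk> \<Longrightarrow>
          K s u n = bind_pmf (K s t n) (K t u)"
    and branching: "\<And>s t n. \<lbrakk>0 \<le> s; s \<le> t\<rbrakk> \<Longrightarrow>
          K s t n = map_pmf sum_list (replicate_pmf n (K s t 1))"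
    and no_death: "\<And>T \<epsilon>. \<lbrakk>0 \<le> T; 0 < \<epsilon>\<rbrakk> \<Longrightarrow>
          \<exists>\<delta>>0. \<forall>s t. 0 \<le> s \<and> s \<le> t \<and> t \<le> T \<and> t - s < \<delta> \<longrightarrow>
            \<bar>pmf (K s t 1) 1 - (1 - (cum_rate lam t - cum_rate lam s))\<bar>
              \<le> \<epsilon> * (cum_rate lam t - cum_rate lam s)"
    and death: "\<And>T \<epsilon> j. \<lbrakk>0 \<le> T; 0 < \<epsilon>; j \<noteq> 1\<rbrakk> \<Longrightarrow>
          \<exists>\<delta>>0. \<forall>s t. 0 \<le> s \<and> s \<le> t \<and> t \<le> T \<and> t - s < \<delta> \<longrightarrow>
            \<bar>pmf (K s t 1) j - (LBINT u:{s..t}. lam u * pmf (p u) j)\<bar>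
              \<le> \<epsilon> * (cum_rate lam t - cum_rate lam s)"

text \<open>\<open>uniform_measure M A\<close> is the conditional measure of \<open>M\<close> given the event \<open>A\<close>.\<close>

definition survival_event :: "'w measure \<Rightarrow> (real \<Rightarrow> 'w \<Rightarrow> nat) \<Rightarrow> real \<Rightarrow> 'w set" where
  "survival_event M Z t = {\<omega> \<in> space M. Z t \<omega> > 0}"

definition bp_mean :: "'w measure \<Rightarrow> (real \<Rightarrow> 'w \<Rightarrow> nat) \<Rightarrow> real \<Rightarrow> real" where
  "bp_mean M Z t = (LINT \<omega>|M. real (Z t \<omega>))"

definition bp_cond_mean :: "'w measure \<Rightarrow> (real \<Rightarrow> 'w \<Rightarrow> nat) \<Rightarrow> real \<Rightarrow> real" where
  "bp_cond_mean M Z t = (LINT \<omega>|uniform_measure M (survival_event M Z t). real (Z t \<omega>))"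

definition bp_extinction_prob :: "'w measure \<Rightarrow> (real \<Rightarrow> 'w \<Rightarrow> nat) \<Rightarrow> real" where
  "bp_extinction_prob M Z = Lim at_top (\<lambda>t. measure M {\<omega> \<in> space M. Z t \<omega> = 0})"

definition bp_V :: "'w measure \<Rightarrow> (real \<Rightarrow> 'w \<Rightarrow> nat) \<Rightarrow> real \<Rightarrow> (real \<Rightarrow> real) \<Rightarrow> real \<Rightarrow> real" where
  "bp_V M Z \<theta> lam t = \<theta> / (1 + \<theta>) * (LBINT u:{0..t}. bp_mean M Z u powr (- \<theta>) * lam u)"

definition bp_V_lim :: "'w measure \<Rightarrow> (real \<Rightarrow> 'w \<Rightarrow> nat) \<Rightarrow> real \<Rightarrow> (real \<Rightarrow> real) \<Rightarrow> ereal" where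
  "bp_V_lim M Z \<theta> lam = Lim at_top (\<lambda>t. ereal (bp_V M Z \<theta> lam t))"

definition bp_critical :: "'w measure \<Rightarrow> (real \<Rightarrow> 'w \<Rightarrow> nat) \<Rightarrow> bool" where
  "bp_critical M Z \<longleftrightarrow>
     bp_extinction_prob M Z = 1 \<and> filterlim (bp_cond_mean M Z) at_top at_top"

end

theory Submission
  imports Defs
begin

text \<open>
  Write \<open>\<Lambda>\<close> for the integral of \<open>lam\<close> and \<open>B\<close> for the integral of
  \<open>a d\<Lambda>\<close>, and let \<open>G s\<close> be one minus the generating function, at a fixed \<open>x <
  1\<close>, of the population at time \<open>T\<close> started from one individual at time \<open>s\<close>. The
  branching property and the Chapman--Kolmogorov equation turn the short-time behaviour of one individual into the
  backward equation \<open>dG = G d\<Lambda> - (G - G\<^sup>1\<^sup>+\<^sup>\<theta> / (1 + \<theta>)) dB\<close>. It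
  is a Bernoulli equation: \<open>G\<^sup>-\<^sup>\<theta>\<close> satisfies a linear one, and with \<open>\<mu> = exp
  (B - \<Lambda>)\<close> the function \<open>\<mu>\<^sup>-\<^sup>\<theta> G\<^sup>-\<^sup>\<theta> + V -
  \<mu>\<^sup>-\<^sup>\<theta> / (1 + \<theta>)\<close> does not change in time. Comparing its values at
  \<open>0\<close> and \<open>T\<close> gives the closed formula (\<open>survival_pgf_formula\<close>)

  \<open>(1 - E x\<^bsup>Z T\<^esup>)\<^sup>-\<^sup>\<theta> = V T + 1 / (1 + \<theta>) + \<mu> T\<^sup>-\<^sup>\<theta> ((1 - x)\<^sup>-\<^sup>\<theta> - 1 / (1 + \<theta>))\<close>,

  from which everything follows. Letting \<open>x \<rightarrow> 1\<close> identifies \<open>\<mu>\<close> as the mean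
  (\<open>mean_K\<close>), and \<open>x = 0\<close> gives \<open>P (Z T > 0)\<^sup>-\<^sup>\<theta> = V + 1 / (1 +
  \<theta>) + \<theta> \<mu>\<^sup>-\<^sup>\<theta> / (1 + \<theta>)\<close>. The conditional mean is \<open>m = \<mu>
  / P (Z T > 0)\<close>, so that \<open>m\<^sup>\<theta> = \<mu>\<^sup>\<theta> (V + 1 / (1 + \<theta>)) + \<theta> /
  (1 + \<theta>)\<close>. If \<open>V\<close> stayed bounded, extinction would force \<open>\<mu> \<rightarrow>
  0\<close>, while \<open>m \<rightarrow> \<infinity>\<close> would force \<open>\<mu> \<rightarrow>
  \<infinity>\<close>; hence criticality is \<open>V \<rightarrow> \<infinity>\<close> together with
  \<open>\<mu>\<^sup>\<theta> V \<rightarrow> \<infinity>\<close> (\<open>critical_iff\<close>). In that case all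
  terms other than \<open>V\<close> in the formula for \<open>P (Z T > 0)\<^sup>-\<^sup>\<theta>\<close> are
  negligible, and inserting \<open>x = exp (- w / m)\<close> adds to it a term asymptotic to
  \<open>\<mu>\<^sup>-\<^sup>\<theta> (w / m)\<^sup>-\<^sup>\<theta> \<sim> w\<^sup>-\<^sup>\<theta> V\<close>, which
  gives the Laplace transform of the limit law.

  Since the rates are only measurable, the backward equation is not differentiated anywhere. It is read as an
  expansion of increments along the two clocks \<open>\<Lambda>\<close> and \<open>B\<close> with an error that is
  uniformly \<open>o(\<Delta>\<Lambda>)\<close>. Such expansions are stable under linear combinations and under
  composition with \<open>C\<^sup>1\<close> functions, and a function whose expansion vanishes is constant; this is
  all the calculus that solving the equation needs.
\<close>

section \<open>First-order expansions along two clocks\<close>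

text \<open>
  Steps of length \<open>\<delta> / 2\<close> lead from \<open>T\<close> back to any point of the interval, and a step may have length
  \<open>0\<close>; so one and the same number \<open>N\<close> of steps serves for all points, and a property that
  deteriorates with each step deteriorates only by a bounded amount.
\<close>

lemma backward_induct_steps:
  fixes P :: "nat \<Rightarrow> real \<Rightarrow> bool"
  assumes base: "P 0 T" and \<delta>: "0 < \<delta>"
    and step: "\<And>n s r. \<lbrakk>0 \<le> s; s \<le> r; r \<le> T; r - s < \<delta>; P n r\<rbrakk> \<Longrightarrow> P (Suc n) s"
  shows "\<exists>N. \<forall>s. 0 \<le> s \<and> s \<le> T \<longrightarrow> P N s"
proof -
  have *: "P n s" if "0 \<le> s" "s \<le> T" "T - s \<le> real n * (\<delta> / 2)" for n s
    using that
  proof (induction n arbitrary: s)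
    case 0
    then show ?case using base by simp
  next
    case (Suc n)
    define r where "r = min T (s + \<delta> / 2)"
    have r: "0 \<le> r" "s \<le> r" "r \<le> T" "r - s < \<delta>" "T - r \<le> real n * (\<delta> / 2)"
      using Suc.prems \<delta> by (auto simp: r_def min_def algebra_simps)
    with Suc.IH[of r] have "P n r" by blast
    then show ?case using step[of s r n] r Suc.prems by blast
  qed
  obtain N where N: "T / (\<delta> / 2) \<le> real N"
    using real_arch_simple by blast
  show ?thesis
  proof (intro exI[of _ N] allI impI)
    fix s assume s: "0 \<le> s \<and> s \<le> T"
    then have "T - s \<le> real N * (\<delta> / 2)"
      using N \<delta> by (simp add: field_simps)
    then show "P N s" using s by (intro *) auto
  qed
qed

text \<open>
  Errors are measured in units of \<open>L\<close> alone. An increment of \<open>A\<close> is at most of the same order, so it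
  may enter the leading terms without affecting which errors are negligible.
\<close>

locale clock_pair =
  fixes T C :: real and L A :: "real \<Rightarrow> real"
  assumes T_nonneg: "0 \<le> T" and C_nonneg: "0 \<le> C"
    and L_continuous: "continuous_on {0..T} L"
    and L_mono: "\<And>s r. \<lbrakk>0 \<le> s; s \<le> r; r \<le> T\<rbrakk> \<Longrightarrow> L s \<le> L r"
    and A_lipschitz: "\<And>s r. \<lbrakk>0 \<le> s; s \<le> r; r \<le> T\<rbrakk> \<Longrightarrow> \<bar>A r - A s\<bar> \<le> C * (L r - L s)"
begin

text \<open>
  This is the integral equation \<open>df = - \<alpha> dL - \<beta> dA\<close> in the only form in which it is used. The
  coefficients are taken at the right end point of the short interval because the backward
  equation expresses the past \<open>s\<close> through the future \<open>r\<close>.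
\<close>

definition expands :: "(real \<Rightarrow> real) \<Rightarrow> (real \<Rightarrow> real) \<Rightarrow> (real \<Rightarrow> real) \<Rightarrow> bool" where
  "expands f \<alpha> \<beta> \<longleftrightarrow> (\<forall>\<epsilon>>0. \<exists>\<delta>>0. \<forall>s r. 0 \<le> s \<and> s \<le> r \<and> r \<le> T \<and> r - s < \<delta> \<longrightarrow>
     \<bar>f s - f r - \<alpha> r * (L r - L s) - \<beta> r * (A r - A s)\<bar> \<le> \<epsilon> * (L r - L s))"

lemma expandsD:
  assumes "expands f \<alpha> \<beta>" "0 < \<epsilon>"
  obtains \<delta> where "0 < \<delta>"
    "\<And>s r. \<lbrakk>0 \<le> s; s \<le> r; r \<le> T; r - s < \<delta>\<rbrakk> \<Longrightarrow>
       \<bar>f s - f r - \<alpha> r * (L r - L s) - \<beta> r * (A r - A s)\<bar> \<le> \<epsilon> * (L r - L s)"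
  using assms unfolding expands_def by meson

lemma expands_cong:
  assumes "expands f \<alpha> \<beta>"
    and "\<And>s. \<lbrakk>0 \<le> s; s \<le> T\<rbrakk> \<Longrightarrow> f s = f' s"
    and "\<And>s. \<lbrakk>0 \<le> s; s \<le> T\<rbrakk> \<Longrightarrow> \<alpha> s = \<alpha>' s"
    and "\<And>s. \<lbrakk>0 \<le> s; s \<le> T\<rbrakk> \<Longrightarrow> \<beta> s = \<beta>' s"
  shows "expands f' \<alpha>' \<beta>'"
  unfolding expands_def
proof (intro allI impI)
  fix \<epsilon> :: real assume "\<epsilon> > 0"
  from assms(1) this obtain \<delta> where \<delta>: "0 < \<delta>"
    "\<And>s r. \<lbrakk>0 \<le> s; s \<le> r; r \<le> T; r - s < \<delta>\<rbrakk> \<Longrightarrow>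
       \<bar>f s - f r - \<alpha> r * (L r - L s) - \<beta> r * (A r - A s)\<bar> \<le> \<epsilon> * (L r - L s)"
    by (rule expandsD) (use assms in blast)+
  show "\<exists>\<delta>>0. \<forall>s r. 0 \<le> s \<and> s \<le> r \<and> r \<le> T \<and> r - s < \<delta> \<longrightarrow>
     \<bar>f' s - f' r - \<alpha>' r * (L r - L s) - \<beta>' r * (A r - A s)\<bar> \<le> \<epsilon> * (L r - L s)"
  proof (intro exI[of _ \<delta>] conjI allI impI \<delta>(1))
    fix s r assume sr: "0 \<le> s \<and> s \<le> r \<and> r \<le> T \<and> r - s < \<delta>"
    then show "\<bar>f' s - f' r - \<alpha>' r * (L r - L s) - \<beta>' r * (A r - A s)\<bar> \<le> \<epsilon> * (L r - L s)"
      using \<delta>(2)[of s r] assms(2)[of s] assms(2)[of r] assms(3)[of r] assms(4)[of r] by simp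
  qed
qed

lemma expands_linear_clocks: "expands (\<lambda>s. c * L s + d * A s) (\<lambda>_. - c) (\<lambda>_. - d)"
  unfolding expands_def
proof (intro allI impI exI[of _ 1] conjI)
  fix \<epsilon> s r :: real assume "\<epsilon> > 0" "0 \<le> s \<and> s \<le> r \<and> r \<le> T \<and> r - s < 1"
  then have "0 \<le> \<epsilon> * (L r - L s)" using L_mono[of s r] by simp
  then show "\<bar>c * L s + d * A s - (c * L r + d * A r) - - c * (L r - L s) - - d * (A r - A s)\<bar>
      \<le> \<epsilon> * (L r - L s)"
    by (simp add: algebra_simps)
qed simp

lemma expands_add:
  assumes "expands f \<alpha> \<beta>" "expands g \<alpha>' \<beta>'"
  shows "expands (\<lambda>s. f s + g s) (\<lambda>s. \<alpha> s + \<alpha>' s) (\<lambda>s. \<beta> s + \<beta>' s)"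
  unfolding expands_def
proof (intro allI impI)
  fix \<epsilon> :: real assume "\<epsilon> > 0"
  then have "\<epsilon> / 2 > 0" by simp
  from assms(1) this obtain \<delta> where \<delta>: "0 < \<delta>"
    "\<And>s r. \<lbrakk>0 \<le> s; s \<le> r; r \<le> T; r - s < \<delta>\<rbrakk> \<Longrightarrow>
       \<bar>f s - f r - \<alpha> r * (L r - L s) - \<beta> r * (A r - A s)\<bar> \<le> \<epsilon> / 2 * (L r - L s)"
    by (rule expandsD) blast
  from assms(2) \<open>\<epsilon> / 2 > 0\<close> obtain \<delta>' where \<delta>': "0 < \<delta>'"
    "\<And>s r. \<lbrakk>0 \<le> s; s \<le> r; r \<le> T; r - s < \<delta>'\<rbrakk> \<Longrightarrow>
       \<bar>g s - g r - \<alpha>' r * (L r - L s) - \<beta>' r * (A r - A s)\<bar> \<le> \<epsilon> / 2 * (L r - L s)"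
    by (rule expandsD) blast
  show "\<exists>\<delta>>0. \<forall>s r. 0 \<le> s \<and> s \<le> r \<and> r \<le> T \<and> r - s < \<delta> \<longrightarrow>
     \<bar>f s + g s - (f r + g r) - (\<alpha> r + \<alpha>' r) * (L r - L s) - (\<beta> r + \<beta>' r) * (A r - A s)\<bar>
       \<le> \<epsilon> * (L r - L s)"
  proof (intro exI[of _ "min \<delta> \<delta>'"] conjI allI impI)
    fix s r assume sr: "0 \<le> s \<and> s \<le> r \<and> r \<le> T \<and> r - s < min \<delta> \<delta>'"
    have eq: "f s + g s - (f r + g r) - (\<alpha> r + \<alpha>' r) * (L r - L s) - (\<beta> r + \<beta>' r) * (A r - A s)
        = (f s - f r - \<alpha> r * (L r - L s) - \<beta> r * (A r - A s))
          + (g s - g r - \<alpha>' r * (L r - L s) - \<beta>' r * (A r - A s))"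
      by (simp add: algebra_simps)
    show "\<bar>f s + g s - (f r + g r) - (\<alpha> r + \<alpha>' r) * (L r - L s) - (\<beta> r + \<beta>' r) * (A r - A s)\<bar>
       \<le> \<epsilon> * (L r - L s)"
      unfolding eq using \<delta>(2)[of s r] \<delta>'(2)[of s r] sr by linarith
  qed (use \<delta> \<delta>' in simp)
qed

lemma expands_cmult:
  assumes "expands f \<alpha> \<beta>"
  shows "expands (\<lambda>s. c * f s) (\<lambda>s. c * \<alpha> s) (\<lambda>s. c * \<beta> s)"
  unfolding expands_def
proof (intro allI impI)
  fix \<epsilon> :: real assume "\<epsilon> > 0"
  then have pos: "\<epsilon> / (\<bar>c\<bar> + 1) > 0" by simp
  from assms(1) this obtain \<delta> where \<delta>: "0 < \<delta>"
    "\<And>s r. \<lbrakk>0 \<le> s; s \<le> r; r \<le> T; r - s < \<delta>\<rbrakk> \<Longrightarrow>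
       \<bar>f s - f r - \<alpha> r * (L r - L s) - \<beta> r * (A r - A s)\<bar> \<le> \<epsilon> / (\<bar>c\<bar> + 1) * (L r - L s)"
    by (rule expandsD) blast
  show "\<exists>\<delta>>0. \<forall>s r. 0 \<le> s \<and> s \<le> r \<and> r \<le> T \<and> r - s < \<delta> \<longrightarrow>
     \<bar>c * f s - c * f r - c * \<alpha> r * (L r - L s) - c * \<beta> r * (A r - A s)\<bar> \<le> \<epsilon> * (L r - L s)"
  proof (intro exI[of _ \<delta>] conjI allI impI \<delta>(1))
    fix s r assume sr: "0 \<le> s \<and> s \<le> r \<and> r \<le> T \<and> r - s < \<delta>"
    have "\<bar>c * f s - c * f r - c * \<alpha> r * (L r - L s) - c * \<beta> r * (A r - A s)\<bar>
        = \<bar>c\<bar> * \<bar>f s - f r - \<alpha> r * (L r - L s) - \<beta> r * (A r - A s)\<bar>"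
      by (simp add: abs_mult [symmetric] algebra_simps)
    also have "\<dots> \<le> (\<bar>c\<bar> + 1) * (\<epsilon> / (\<bar>c\<bar> + 1) * (L r - L s))"
      using \<delta>(2)[of s r] sr by (intro mult_mono) auto
    also have "\<dots> = \<epsilon> * (L r - L s)" by (simp add: add_nonneg_pos less_imp_neq[THEN not_sym])
    finally show "\<bar>c * f s - c * f r - c * \<alpha> r * (L r - L s) - c * \<beta> r * (A r - A s)\<bar>
        \<le> \<epsilon> * (L r - L s)" .
  qed
qed

lemma clock_small:
  assumes "0 < \<eta>"
  obtains \<delta> where "0 < \<delta>"
    "\<And>s r. \<lbrakk>0 \<le> s; s \<le> r; r \<le> T; r - s < \<delta>\<rbrakk> \<Longrightarrow> L r - L s < \<eta>"
proof -
  have "uniformly_continuous_on {0..T} L"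
    using L_continuous by (intro compact_uniformly_continuous) auto
  then obtain \<delta> where "\<delta> > 0" and \<delta>: "\<And>x y. \<lbrakk>x \<in> {0..T}; y \<in> {0..T}; dist y x < \<delta>\<rbrakk> \<Longrightarrow> dist (L y) (L x) < \<eta>"
    using assms unfolding uniformly_continuous_on_def by metis
  show thesis
  proof
    fix s r assume "0 \<le> s" "s \<le> r" "r \<le> T" "r - s < \<delta>"
    then have "dist (L r) (L s) < \<eta>" by (intro \<delta>) (auto simp: dist_real_def)
    then show "L r - L s < \<eta>" by (simp add: dist_real_def)
  qed fact
qed

text \<open>
  The errors of the steps of a partition add up to at most \<open>\<epsilon> (L T - L 0)\<close>, for every \<open>\<epsilon>\<close>.
\<close>

lemma expands_zero_imp_const:
  assumes f: "expands f (\<lambda>_. 0) (\<lambda>_. 0)"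
  shows "f 0 = f T"
proof -
  have "\<bar>f 0 - f T\<bar> \<le> \<epsilon> * (L T - L 0)" if "\<epsilon> > 0" for \<epsilon>
  proof -
    from f that obtain \<delta> where \<delta>: "0 < \<delta>"
      "\<And>s r. \<lbrakk>0 \<le> s; s \<le> r; r \<le> T; r - s < \<delta>\<rbrakk> \<Longrightarrow>
       \<bar>f s - f r - 0 * (L r - L s) - 0 * (A r - A s)\<bar> \<le> \<epsilon> * (L r - L s)"
      by (rule expandsD) blast
    have step: "\<bar>f s - f T\<bar> \<le> \<epsilon> * (L T - L s)"
      if "0 \<le> s" "s \<le> r" "r \<le> T" "r - s < \<delta>" "\<bar>f r - f T\<bar> \<le> \<epsilon> * (L T - L r)" for s r
      using \<delta>(2)[of s r] that by (simp add: algebra_simps)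
    have "\<bar>f T - f T\<bar> \<le> \<epsilon> * (L T - L T)" by simp
    then have "\<exists>N::nat. \<forall>s. 0 \<le> s \<and> s \<le> T \<longrightarrow> \<bar>f s - f T\<bar> \<le> \<epsilon> * (L T - L s)"
      by (rule backward_induct_steps[where P = "\<lambda>_ s. \<bar>f s - f T\<bar> \<le> \<epsilon> * (L T - L s)",
            OF _ \<delta>(1) step])
    then show ?thesis using T_nonneg by simp
  qed
  note * = this
  have "\<bar>f 0 - f T\<bar> \<le> 0"
  proof (rule field_le_epsilon)
    fix e :: real assume e: "e > 0"
    have L0: "0 \<le> L T - L 0" using L_mono[of 0 T] T_nonneg by simp
    have "\<bar>f 0 - f T\<bar> \<le> e / (L T - L 0 + 1) * (L T - L 0)"
      using e L0 by (intro *) simp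
    also have "\<dots> \<le> e" using e L0 by (simp add: field_simps)
    finally show "\<bar>f 0 - f T\<bar> \<le> 0 + e" by simp
  qed
  then show ?thesis by simp
qed

text \<open>
  The chain rule. By the mean value theorem, \<open>\<psi> (f s) - \<psi> (f r)\<close> is \<open>\<psi>' (f r) (f s - f r)\<close> up to a
  small multiple of \<open>f s - f r\<close>. Boundedness of the coefficients makes \<open>f s - f r\<close> itself at most a
  constant times \<open>L r - L s\<close>, which is small on short intervals because \<open>L\<close> is uniformly
  continuous.
\<close>

lemma expands_compose:
  assumes f: "expands f \<alpha> \<beta>"
    and range: "\<And>s. \<lbrakk>0 \<le> s; s \<le> T\<rbrakk> \<Longrightarrow> f s \<in> {l..h}"
    and bound: "\<And>s. \<lbrakk>0 \<le> s; s \<le> T\<rbrakk> \<Longrightarrow> \<bar>\<alpha> s\<bar> \<le> c \<and> \<bar>\<beta> s\<bar> \<le> c"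
    and deriv: "\<And>x. x \<in> {l..h} \<Longrightarrow> (\<psi> has_field_derivative \<psi>' x) (at x)"
    and cont: "continuous_on {l..h} \<psi>'"
  shows "expands (\<lambda>s. \<psi> (f s)) (\<lambda>s. \<psi>' (f s) * \<alpha> s) (\<lambda>s. \<psi>' (f s) * \<beta> s)"
  unfolding expands_def
proof (intro allI impI)
  fix \<epsilon> :: real assume "\<epsilon> > 0"
  have c0: "0 \<le> c" using bound[of T] T_nonneg by force
  (* R bounds the increments of f per unit of L: c and c * C come from the two coefficients,
     1 from the error of the expansion. *)
  define R where "R = c + c * C + 1"
  have R: "R > 0" using c0 C_nonneg by (simp add: R_def add_nonneg_pos)
  obtain P where P: "P > 0" "\<And>x. x \<in> {l..h} \<Longrightarrow> \<bar>\<psi>' x\<bar> \<le> P"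
    using compact_imp_bounded[OF compact_continuous_image[OF cont]]
    by (auto simp: bounded_pos image_iff)
  define \<eta> where "\<eta> = \<epsilon> / (2 * R)"
  have \<eta>: "\<eta> > 0" using \<open>\<epsilon> > 0\<close> R by (simp add: \<eta>_def)
  have "uniformly_continuous_on {l..h} \<psi>'"
    using cont by (intro compact_uniformly_continuous) auto
  then obtain d where d: "d > 0"
    "\<And>x y. \<lbrakk>x \<in> {l..h}; y \<in> {l..h}; dist y x < d\<rbrakk> \<Longrightarrow> dist (\<psi>' y) (\<psi>' x) < \<eta>"
    using \<eta> unfolding uniformly_continuous_on_def by metis
  define \<epsilon>' where "\<epsilon>' = min 1 (\<epsilon> / (2 * P))"
  have \<epsilon>': "0 < \<epsilon>'" "\<epsilon>' \<le> 1" "\<epsilon>' \<le> \<epsilon> / (2 * P)" using \<open>\<epsilon> > 0\<close> P by (auto simp: \<epsilon>'_def)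
  from f \<epsilon>'(1) obtain \<delta>1 where \<delta>1: "0 < \<delta>1"
    "\<And>s r. \<lbrakk>0 \<le> s; s \<le> r; r \<le> T; r - s < \<delta>1\<rbrakk> \<Longrightarrow>
       \<bar>f s - f r - \<alpha> r * (L r - L s) - \<beta> r * (A r - A s)\<bar> \<le> \<epsilon>' * (L r - L s)"
    by (rule expandsD) blast
  have "d / R > 0" using d R by simp
  then obtain \<delta>2 where \<delta>2: "0 < \<delta>2"
    "\<And>s r. \<lbrakk>0 \<le> s; s \<le> r; r \<le> T; r - s < \<delta>2\<rbrakk> \<Longrightarrow> L r - L s < d / R"
    by (rule clock_small) blast
  show "\<exists>\<delta>>0. \<forall>s r. 0 \<le> s \<and> s \<le> r \<and> r \<le> T \<and> r - s < \<delta> \<longrightarrow>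
     \<bar>\<psi> (f s) - \<psi> (f r) - \<psi>' (f r) * \<alpha> r * (L r - L s) - \<psi>' (f r) * \<beta> r * (A r - A s)\<bar>
       \<le> \<epsilon> * (L r - L s)"
  proof (intro exI[of _ "min \<delta>1 \<delta>2"] conjI allI impI)
    fix s r assume "0 \<le> s \<and> s \<le> r \<and> r \<le> T \<and> r - s < min \<delta>1 \<delta>2"
    then have sr: "0 \<le> s" "s \<le> r" "r \<le> T" "r - s < \<delta>1" "r - s < \<delta>2" "0 \<le> r" "s \<le> T" by auto
    define D where "D = L r - L s"
    define E where "E = \<alpha> r * (L r - L s) + \<beta> r * (A r - A s)"
    have D: "0 \<le> D" "D < d / R" using L_mono sr \<delta>2 by (auto simp: D_def)
    have e1: "\<bar>f s - f r - E\<bar> \<le> \<epsilon>' * D" using \<delta>1(2)[of s r] sr by (simp add: D_def E_def algebra_simps)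
    have "\<bar>E\<bar> \<le> \<bar>\<alpha> r\<bar> * D + \<bar>\<beta> r\<bar> * \<bar>A r - A s\<bar>"
      using abs_triangle_ineq[of "\<alpha> r * D" "\<beta> r * (A r - A s)"] D
      by (simp add: E_def D_def abs_mult)
    also have "\<dots> \<le> c * D + c * (C * D)"
      using bound[of r] sr D A_lipschitz[of s r] c0 by (intro add_mono mult_mono) (auto simp: D_def)
    finally have e2: "\<bar>E\<bar> \<le> c * D + c * C * D" by simp
    have "\<bar>f s - f r\<bar> \<le> \<epsilon>' * D + (c * D + c * C * D)" using e1 e2 by linarith
    also have "\<dots> \<le> 1 * D + (c * D + c * C * D)"
      using mult_right_mono[OF \<epsilon>'(2) D(1)] by simp
    also have "\<dots> = R * D" by (simp add: R_def algebra_simps)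
    finally have e3: "\<bar>f s - f r\<bar> \<le> R * D" .
    also have "R * D < d" using D R by (simp add: field_simps)
    finally have e4: "\<bar>f s - f r\<bar> < d" .
    have mv: "\<bar>\<psi> (f s) - \<psi> (f r) - \<psi>' (f r) * (f s - f r)\<bar> \<le> \<eta> * \<bar>f s - f r\<bar>"
    proof -
      have "\<exists>z. z \<in> {l..h} \<and> \<bar>z - f r\<bar> \<le> \<bar>f s - f r\<bar> \<and> \<psi> (f s) - \<psi> (f r) = (f s - f r) * \<psi>' z"
      proof (cases "f s" "f r" rule: linorder_cases)
        case less
        have "\<exists>z>f s. z < f r \<and> \<psi> (f r) - \<psi> (f s) = (f r - f s) * \<psi>' z"
          using less range[of s] range[of r] sr by (intro MVT2 deriv) auto
        then obtain z where "z > f s" "z < f r" "\<psi> (f r) - \<psi> (f s) = (f r - f s) * \<psi>' z" by blast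
        then show ?thesis using range[of s] range[of r] sr
          by (intro exI[of _ z]) (auto simp: algebra_simps)
      next
        case equal
        then show ?thesis using range[of r] sr by (intro exI[of _ "f r"]) auto
      next
        case greater
        have "\<exists>z>f r. z < f s \<and> \<psi> (f s) - \<psi> (f r) = (f s - f r) * \<psi>' z"
          using greater range[of s] range[of r] sr by (intro MVT2 deriv) auto
        then obtain z where "z > f r" "z < f s" "\<psi> (f s) - \<psi> (f r) = (f s - f r) * \<psi>' z" by blast
        then show ?thesis using range[of s] range[of r] sr
          by (intro exI[of _ z]) (auto simp: algebra_simps)
      qed
      then obtain z where z: "z \<in> {l..h}" "\<bar>z - f r\<bar> \<le> \<bar>f s - f r\<bar>"
        "\<psi> (f s) - \<psi> (f r) = (f s - f r) * \<psi>' z" by blast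
      have "dist (\<psi>' z) (\<psi>' (f r)) < \<eta>"
        using z e4 range[of r] sr by (intro d(2)) (auto simp: dist_real_def)
      then have "\<bar>\<psi>' z - \<psi>' (f r)\<bar> * \<bar>f s - f r\<bar> \<le> \<eta> * \<bar>f s - f r\<bar>"
        by (intro mult_right_mono) (auto simp: dist_real_def)
      then show ?thesis using z(3) by (simp add: abs_mult [symmetric] algebra_simps)
    qed
    have "\<psi> (f s) - \<psi> (f r) - \<psi>' (f r) * E
        = (\<psi> (f s) - \<psi> (f r) - \<psi>' (f r) * (f s - f r)) + \<psi>' (f r) * (f s - f r - E)"
      by (simp add: algebra_simps)
    also have "\<bar>\<dots>\<bar> \<le> \<eta> * \<bar>f s - f r\<bar> + \<bar>\<psi>' (f r)\<bar> * \<bar>f s - f r - E\<bar>"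
      using mv by (intro order_trans[OF abs_triangle_ineq] add_mono) (auto simp: abs_mult)
    also have "\<dots> \<le> \<eta> * (R * D) + P * (\<epsilon>' * D)"
      using e1 e3 \<eta> P(1) P(2)[of "f r"] range[of r] sr
      by (intro add_mono mult_mono) auto
    also have "\<eta> * (R * D) = \<epsilon> / 2 * D" using R by (simp add: \<eta>_def)
    also have "P * (\<epsilon>' * D) \<le> P * (\<epsilon> / (2 * P) * D)"
      using P \<epsilon>' D by (intro mult_left_mono mult_right_mono) auto
    also have "\<dots> = \<epsilon> / 2 * D" using P by simp
    finally show "\<bar>\<psi> (f s) - \<psi> (f r) - \<psi>' (f r) * \<alpha> r * (L r - L s) - \<psi>' (f r) * \<beta> r * (A r - A s)\<bar>
       \<le> \<epsilon> * (L r - L s)"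
      by (simp add: D_def E_def algebra_simps)
  qed (use \<delta>1 \<delta>2 in simp)
qed

end

section \<open>Generating functions of laws on the natural numbers\<close>

definition pgf :: "nat pmf \<Rightarrow> real \<Rightarrow> real" where
  "pgf q x = measure_pmf.expectation q (\<lambda>k. x ^ k)"

lemma integrable_pmf_power:
  fixes x :: real
  assumes "0 \<le> x" "x \<le> 1"
  shows "integrable (measure_pmf q) (\<lambda>k. x ^ k)"
  using assms by (intro measure_pmf.integrable_const_bound[where B = 1]) (auto simp: power_le_one)

lemma pgf_sums:
  assumes "0 \<le> x" "x \<le> 1"
  shows "(\<lambda>k. pmf q k * x ^ k) sums pgf q x"
proof -
  have "integrable (count_space UNIV) (\<lambda>k. pmf q k * x ^ k)"
    using integrable_pmf_power[OF assms, of q]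
    by (simp add: measure_pmf_eq_density integrable_density)
  then have "(\<lambda>k. pmf q k * x ^ k) sums integral\<^sup>L (count_space UNIV) (\<lambda>k. pmf q k * x ^ k)"
    by (rule sums_integral_count_space_nat)
  also have "integral\<^sup>L (count_space UNIV) (\<lambda>k. pmf q k * x ^ k) = pgf q x"
    by (simp add: pgf_def measure_pmf_eq_density integral_density)
  finally show ?thesis .
qed

lemma pgf_nonneg: "0 \<le> x \<Longrightarrow> 0 \<le> pgf q x"
  by (simp add: pgf_def)

lemma pgf_le_1:
  assumes "0 \<le> x" "x \<le> 1"
  shows "pgf q x \<le> 1"
proof -
  have "pgf q x \<le> measure_pmf.expectation q (\<lambda>_. 1)"
    unfolding pgf_def using assms
    by (intro integral_mono integrable_pmf_power) (auto simp: power_le_one)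
  then show ?thesis by simp
qed

lemma pgf_0: "pgf q 0 = pmf q 0"
  using sums_unique2[OF pgf_sums[of 0 q]] by (simp add: powser_sums_zero)

lemma pgf_at_1: "pgf q 1 = 1"
  by (simp add: pgf_def)

lemma pgf_return: "pgf (return_pmf n) x = x ^ n"
  by (simp add: pgf_def)

lemma pgf_bind:
  assumes "0 \<le> x" "x \<le> 1"
  shows "pgf (bind_pmf q f) x = measure_pmf.expectation q (\<lambda>n. pgf (f n) x)"
proof -
  have eq: "ennreal (pgf r x) = (\<integral>\<^sup>+k. ennreal (x ^ k) \<partial>measure_pmf r)" for r
    unfolding pgf_def
    using assms by (intro nn_integral_eq_integral[symmetric] integrable_pmf_power) auto
  have int: "integrable (measure_pmf q) (\<lambda>n. pgf (f n) x)"
    using assms pgf_nonneg pgf_le_1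
    by (intro measure_pmf.integrable_const_bound[where B = 1]) auto
  have "ennreal (pgf (bind_pmf q f) x) = (\<integral>\<^sup>+n. ennreal (pgf (f n) x) \<partial>measure_pmf q)"
    by (simp add: eq)
  also have "\<dots> = ennreal (measure_pmf.expectation q (\<lambda>n. pgf (f n) x))"
    using assms pgf_nonneg by (intro nn_integral_eq_integral int) auto
  finally show ?thesis
    using assms by (simp add: pgf_nonneg integral_nonneg_AE)
qed

lemma pgf_sum_replicate:
  assumes "0 \<le> x" "x \<le> 1"
  shows "pgf (map_pmf sum_list (replicate_pmf n q)) x = pgf q x ^ n"
proof (induction n)
  case 0
  then show ?case by (simp add: pgf_return)
next
  case (Suc n)
  have "map_pmf sum_list (replicate_pmf (Suc n) q)
      = bind_pmf q (\<lambda>k. map_pmf (\<lambda>m. k + m) (map_pmf sum_list (replicate_pmf n q)))"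
    by (simp add: map_bind_pmf map_pmf_def bind_assoc_pmf bind_return_pmf)
  moreover have "pgf (map_pmf (\<lambda>m. k + m) r) x = x ^ k * pgf r x" for k r
    by (simp add: pgf_def power_add)
  ultimately have "pgf (map_pmf sum_list (replicate_pmf (Suc n) q)) x
      = measure_pmf.expectation q (\<lambda>k. x ^ k * pgf q x ^ n)"
    using assms by (simp add: pgf_bind Suc.IH)
  then show ?case by (simp add: pgf_def)
qed

text \<open>
  The left-hand side is the contribution of the value \<open>k = 1\<close> to the expectation of \<open>1 - x\<^bsup>k\<^esup>\<close>.
\<close>

lemma one_minus_pgf_ge:
  assumes "0 \<le> x" "x \<le> 1"
  shows "pmf q 1 * (1 - x) \<le> 1 - pgf q x"
proof -
  have "pmf q 1 * (1 - x) = measure_pmf.expectation q (\<lambda>k. (1 - x) * indicator {1} k)"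
    by (simp add: measure_pmf_single)
  also have "\<dots> \<le> measure_pmf.expectation q (\<lambda>k. 1 - x ^ k)"
  proof (intro integral_mono Bochner_Integration.integrable_diff integrable_pmf_power assms)
    show "integrable (measure_pmf q) (\<lambda>k. (1 - x) * indicator {1} k)"
      by (intro measure_pmf.integrable_const_bound[where B = "\<bar>1 - x\<bar>"])
        (auto split: split_indicator)
  qed (use assms in \<open>auto simp: power_le_one split: split_indicator\<close>)
  also have "\<dots> = 1 - pgf q x"
    unfolding pgf_def using integrable_pmf_power[OF assms, of q] by simp
  finally show ?thesis .
qed

text \<open>
  Scheffe's argument. Since \<open>K\<close> and \<open>D\<close> have the same total, closeness of finitely many terms and a
  small tail of \<open>D\<close> force the tail of \<open>K\<close> to be small as well. This gives uniformity in the weights,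
  although \<open>K\<close> is controlled only one term at a time.
\<close>

lemma scheffe_powers:
  fixes K D w :: "nat \<Rightarrow> real"
  assumes K: "K sums z" "\<And>k. 0 \<le> K k" and D: "D sums z" "\<And>k. N \<le> k \<Longrightarrow> 0 \<le> D k"
    and w: "\<And>k. \<bar>w k\<bar> \<le> 1"
    and head: "(\<Sum>k<N. \<bar>K k - D k\<bar>) \<le> \<eta>" and tail: "(\<Sum>k. D (k + N)) \<le> \<eta>"
    and sums: "(\<lambda>k. K k * w k) sums u" "(\<lambda>k. D k * w k) sums v"
  shows "\<bar>u - v\<bar> \<le> 4 * \<eta>"
proof -
  have sK: "summable (\<lambda>k. K (k + N))" and sD: "summable (\<lambda>k. D (k + N))"
    using K(1) D(1) by (auto simp: sums_iff summable_iff_shift)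
  have "(\<Sum>k. K (k + N)) + (\<Sum>k<N. K k) = (\<Sum>k. D (k + N)) + (\<Sum>k<N. D k)"
    using K(1) D(1) suminf_split_initial_segment[of K N] suminf_split_initial_segment[of D N]
    by (simp add: sums_iff)
  moreover have "(\<Sum>k<N. D k) - (\<Sum>k<N. K k) \<le> (\<Sum>k<N. \<bar>K k - D k\<bar>)"
    unfolding sum_subtractf[symmetric] by (intro sum_mono) auto
  ultimately have tK: "(\<Sum>k. K (k + N)) \<le> 2 * \<eta>" using head tail by linarith
  define e where "e k = (K k - D k) * w k" for k
  have e_sums: "e sums (u - v)"
    using sums_diff[OF sums] by (simp add: e_def [abs_def] algebra_simps)
  have le: "\<bar>e k\<bar> \<le> \<bar>K k - D k\<bar>" for k
    using mult_left_mono[OF w[of k], of "\<bar>K k - D k\<bar>"] by (simp add: e_def abs_mult)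
  have "\<bar>e (k + N)\<bar> \<le> K (k + N) + D (k + N)" for k
    using le[of "k + N"] K(2)[of "k + N"] D(2)[of "k + N"] by simp
  then have "\<bar>\<Sum>k. e (k + N)\<bar> \<le> (\<Sum>k. K (k + N) + D (k + N))"
    using norm_suminf_le[OF _ summable_add[OF sK sD], of "\<lambda>k. e (k + N)"] by simp
  also have "\<dots> = (\<Sum>k. K (k + N)) + (\<Sum>k. D (k + N))"
    by (rule suminf_add[symmetric, OF sK sD])
  finally have a: "\<bar>\<Sum>k. e (k + N)\<bar> \<le> 3 * \<eta>" using tK tail by simp
  have b: "\<bar>\<Sum>k<N. e k\<bar> \<le> \<eta>"
    using order_trans[OF order_trans[OF sum_abs sum_mono[OF le]] head] .
  have "u - v = (\<Sum>k. e (k + N)) + (\<Sum>k<N. e k)"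
    using e_sums suminf_split_initial_segment[of e N] by (simp add: sums_iff)
  then show ?thesis using a b by linarith
qed

text \<open>
  Generating functions are known on \<open>[0, 1]\<close> only, so uniqueness of the coefficients is needed for
  a series that vanishes to the right of \<open>0\<close>. If all earlier coefficients vanish, dividing by
  \<open>s\<^bsup>n\<^esup>\<close> shows that the coefficient of index \<open>n\<close> is at most a constant times \<open>s\<close>, for every \<open>s\<close>.
\<close>

lemma powser_zero_imp_coeffs_zero:
  fixes d :: "nat \<Rightarrow> real"
  assumes summable: "summable (\<lambda>n. \<bar>d n\<bar>)"
    and zero: "\<And>s. \<lbrakk>0 < s; s < 1\<rbrakk> \<Longrightarrow> (\<lambda>n. d n * s ^ n) sums 0"
  shows "d n = 0"
proof (induction n rule: less_induct)
  case (less n)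
  have s_shift: "summable (\<lambda>k. \<bar>d (k + m)\<bar>)" for m
    by (rule summable_iff_shift[THEN iffD2, OF summable])
  define S where "S = (\<Sum>k. \<bar>d (k + Suc n)\<bar>)"
  have S: "0 \<le> S" unfolding S_def by (intro suminf_nonneg s_shift) auto
  have bound: "\<bar>d n\<bar> \<le> s * S" if s: "0 < s" "s < 1" for s
  proof -
    have ab: "summable (\<lambda>k. \<bar>d (k + Suc n) * s ^ k\<bar>)"
      using s by (intro summable_comparison_test'[OF s_shift[of "Suc n"], of 0])
        (auto simp: abs_mult power_le_one mult_left_le)
    have "(\<lambda>k. d (k + Suc n) * s ^ (k + Suc n)) sums (0 - (\<Sum>k<Suc n. d k * s ^ k))"
      by (rule sums_split_initial_segment[OF zero[OF s]])
    also have "(\<Sum>k<Suc n. d k * s ^ k) = d n * s ^ n"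
      using less by simp
    finally have "(\<lambda>k. d (k + Suc n) * s ^ (k + Suc n) * inverse (s ^ Suc n)) sums
        (- (d n * s ^ n) * inverse (s ^ Suc n))"
      by (intro sums_mult2) simp
    then have "(\<lambda>k. d (k + Suc n) * s ^ k) sums (- d n / s)"
      using s by (simp add: field_simps power_add)
    then have "\<bar>d n / s\<bar> = \<bar>\<Sum>k. d (k + Suc n) * s ^ k\<bar>"
      by (simp add: sums_iff)
    also have "\<dots> \<le> (\<Sum>k. \<bar>d (k + Suc n) * s ^ k\<bar>)"
      by (rule summable_rabs[OF ab])
    also have "\<dots> \<le> S"
      unfolding S_def using s
      by (intro suminf_le ab s_shift) (auto simp: abs_mult power_le_one mult_left_le)
    finally show ?thesis using s by (simp add: field_simps)
  qed
  have "\<bar>d n\<bar> \<le> 0"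
  proof (rule field_le_epsilon)
    fix e :: real assume e: "0 < e"
    define s where "s = min (1 / 2) (e / (S + 1))"
    have s: "0 < s" "s < 1" "s \<le> e / (S + 1)" using e S by (auto simp: s_def)
    have "s * S \<le> e / (S + 1) * S" using s S by (intro mult_right_mono) auto
    also have "\<dots> \<le> e" using e S by (simp add: field_simps)
    finally show "\<bar>d n\<bar> \<le> 0 + e" using bound[OF s(1,2)] by simp
  qed
  then show ?case by simp
qed

section \<open>Integrated rates and offspring laws\<close>

lemma cum_rate_diff:
  assumes f: "set_integrable lborel {0..r} f" and sr: "0 \<le> s" "s \<le> r"
  shows "cum_rate f r - cum_rate f s = (LBINT u:{s..r}. f u)"
proof -
  have "AE x in lborel. x \<noteq> s"
    by (rule AE_lborel_singleton)
  then have "AE x in lborel. \<not> (x \<in> {0..s} \<and> x \<in> {s..r})"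
    by eventually_elim auto
  then have "(LBINT u:{0..s} \<union> {s..r}. f u) = (LBINT u:{0..s}. f u) + (LBINT u:{s..r}. f u)"
    by (rule set_integral_Un_AE) (use sr in \<open>auto intro!: set_integrable_subset[OF f]\<close>)
  moreover have "{0..s} \<union> {s..r} = {0..r}" using sr by auto
  ultimately show ?thesis by (simp add: cum_rate_def)
qed

lemma cum_rate_continuous:
  assumes f: "set_integrable lborel {0..T} f"
  shows "continuous_on {0..T} (cum_rate f)"
proof -
  have "continuous_on {0..T} (\<lambda>t. integral {0..t} f)"
    by (intro indefinite_integral_continuous_1 set_borel_integral_eq_integral(1) f)
  then show ?thesis
    by (rule continuous_on_eq)
      (auto simp: cum_rate_def intro!: set_borel_integral_eq_integral(2)[symmetric]
        set_integrable_subset[OF f])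
qed

lemma cum_rate_0: "cum_rate f 0 = 0"
  unfolding cum_rate_def set_lebesgue_integral_def
  by (rule integral_eq_zero_AE) (use AE_lborel_singleton[of 0] in \<open>auto elim!: eventually_mono\<close>)

context theta_positive_environment
begin

abbreviation \<Lambda> :: "real \<Rightarrow> real" where "\<Lambda> \<equiv> cum_rate lam"

definition B :: "real \<Rightarrow> real" where "B = cum_rate (\<lambda>u. lam u * a u)"

text \<open>
  \<open>1 - a t * \<phi> (1 - y)\<close> is the offspring generating function at \<open>y\<close>.
\<close>

definition \<phi> :: "real \<Rightarrow> real" where "\<phi> g = g - g powr (1 + \<theta>) / (1 + \<theta>)"

lemma weighted_rate_integrable:
  assumes g: "set_borel_measurable lborel {0..T} g"
    and bound: "\<And>u. \<lbrakk>0 \<le> u; u \<le> T\<rbrakk> \<Longrightarrow> \<bar>g u\<bar> \<le> c" and T: "0 \<le> T"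
  shows "set_integrable lborel {0..T} (\<lambda>u. lam u * g u)"
proof -
  have c: "0 \<le> c" using bound[of 0] T by linarith
  have "set_integrable lborel {0..T} (\<lambda>u. c * lam u)"
    using lam_integrable[OF T] by simp
  moreover have "set_borel_measurable lborel {0..T} (\<lambda>u. lam u * g u)"
  proof -
    have "set_borel_measurable lborel {0..T} lam"
      using lam_measurable by (rule set_borel_measurable_subset) auto
    then have "(\<lambda>u. (indicator {0..T} u *\<^sub>R lam u) * (indicator {0..T} u *\<^sub>R g u)) \<in> borel_measurable lborel"
      using g unfolding set_borel_measurable_def by (rule borel_measurable_times)
    then show ?thesis
      unfolding set_borel_measurable_def
      by (rule measurable_cong[THEN iffD1, rotated]) (auto split: split_indicator)
  qed
  moreover have "AE u in lborel. u \<in> {0..T} \<longrightarrow> norm (lam u * g u) \<le> norm (c * lam u)"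
  proof (intro always_eventually allI impI)
    fix u assume "u \<in> {0..T}"
    then have "\<bar>g u\<bar> * \<bar>lam u\<bar> \<le> c * \<bar>lam u\<bar>" by (intro mult_right_mono bound) auto
    then show "norm (lam u * g u) \<le> norm (c * lam u)"
      using c by (simp add: abs_mult mult.commute)
  qed
  ultimately show ?thesis by (rule set_integrable_bound)
qed

lemma a_bound: "0 \<le> t \<Longrightarrow> \<bar>a t\<bar> \<le> 1 + 1 / \<theta>"
  using a_nonneg a_upper by simp

lemma birth_integrable: "0 \<le> T \<Longrightarrow> set_integrable lborel {0..T} (\<lambda>u. lam u * a u)"
  by (rule weighted_rate_integrable[where c = "1 + 1 / \<theta>"])
    (auto intro: a_bound set_borel_measurable_subset[OF a_measurable])

lemma \<Lambda>_mono: "\<lbrakk>0 \<le> s; s \<le> r\<rbrakk> \<Longrightarrow> \<Lambda> s \<le> \<Lambda> r"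
proof -
  assume sr: "0 \<le> s" "s \<le> r"
  have "0 \<le> (LBINT u:{s..r}. lam u)"
    unfolding set_lebesgue_integral_def
    using sr lam_nonneg by (intro integral_nonneg_AE always_eventually) (auto split: split_indicator)
  then show ?thesis using cum_rate_diff[OF lam_integrable, of r s] sr by simp
qed

lemma B_increment:
  assumes "0 \<le> s" "s \<le> r"
  shows "0 \<le> B r - B s" "B r - B s \<le> (1 + 1 / \<theta>) * (\<Lambda> r - \<Lambda> s)"
proof -
  have eq: "B r - B s = (LBINT u:{s..r}. lam u * a u)"
    unfolding B_def using assms by (intro cum_rate_diff birth_integrable) auto
  show "0 \<le> B r - B s"
    unfolding eq set_lebesgue_integral_def
    using assms lam_nonneg a_nonneg by (intro integral_nonneg_AE always_eventually) (auto split: split_indicator)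
  have "(LBINT u:{s..r}. lam u * a u) \<le> (LBINT u:{s..r}. (1 + 1 / \<theta>) * lam u)"
  proof (rule set_integral_mono)
    show "set_integrable lborel {s..r} (\<lambda>u. lam u * a u)"
      by (rule set_integrable_subset[OF birth_integrable[of r]]) (use assms in auto)
    have "set_integrable lborel {s..r} lam"
      by (rule set_integrable_subset[OF lam_integrable[of r]]) (use assms in auto)
    then show "set_integrable lborel {s..r} (\<lambda>u. (1 + 1 / \<theta>) * lam u)"
      by (rule set_integrable_mult_right)
    show "lam u * a u \<le> (1 + 1 / \<theta>) * lam u" if "u \<in> {s..r}" for u
    proof -
      have "0 \<le> u" using that assms by simp
      then have "lam u * a u \<le> lam u * (1 + 1 / \<theta>)"
        by (intro mult_left_mono a_upper lam_nonneg)
      then show ?thesis by (simp only: mult.commute)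
    qed
  qed
  also have "\<dots> = (1 + 1 / \<theta>) * (LBINT u:{s..r}. lam u)"
    by (rule set_integral_mult_right)
  also have "(LBINT u:{s..r}. lam u) = \<Lambda> r - \<Lambda> s"
    using assms by (intro cum_rate_diff[symmetric] lam_integrable) auto
  finally show "B r - B s \<le> (1 + 1 / \<theta>) * (\<Lambda> r - \<Lambda> s)"
    unfolding eq .
qed

lemma clocks:
  assumes "0 \<le> T"
  shows "clock_pair T (1 + 1 / \<theta>) \<Lambda> B"
proof
  show "continuous_on {0..T} \<Lambda>" by (intro cum_rate_continuous lam_integrable assms)
  show "\<bar>B r - B s\<bar> \<le> (1 + 1 / \<theta>) * (\<Lambda> r - \<Lambda> s)" if "0 \<le> s" "s \<le> r" "r \<le> T" for s r
    using B_increment[OF that(1,2)] by simp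
  show "0 \<le> 1 + 1 / \<theta>" using theta_pos by simp
  show "\<Lambda> s \<le> \<Lambda> r" if "0 \<le> s" "s \<le> r" for s r
    using that by (rule \<Lambda>_mono)
qed (rule assms)

lemma B_continuous: "0 \<le> T \<Longrightarrow> continuous_on {0..T} B"
  unfolding B_def by (intro cum_rate_continuous birth_integrable)

lemma continuous_rate_integrable:
  assumes T: "0 \<le> T" and g: "continuous_on {0..T} g"
  shows "set_integrable lborel {0..T} (\<lambda>u. g u * lam u)"
proof -
  have "bounded (g ` {0..T})"
    by (intro compact_imp_bounded compact_continuous_image g compact_Icc)
  then obtain c where "\<forall>x\<in>g ` {0..T}. norm x \<le> c"
    unfolding bounded_iff by blast
  then have c: "\<bar>g u\<bar> \<le> c" if "u \<in> {0..T}" for u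
    using that by simp
  have "set_borel_measurable lborel {0..T} g"
    using set_measurable_continuous_on[OF _ g] unfolding set_borel_measurable_def by simp
  then show ?thesis
    using weighted_rate_integrable[of T g c] c T by (simp add: mult.commute)
qed

text \<open>
  On a short interval \<open>g\<close> is nearly constant, so its integral against \<open>d\<Lambda>\<close> is nearly \<open>g r * (\<Lambda> r - \<Lambda> s)\<close>.
\<close>

lemma expands_integral:
  assumes T: "0 \<le> T" and g: "continuous_on {0..T} g"
  shows "clock_pair.expands T \<Lambda> B (cum_rate (\<lambda>u. g u * lam u)) (\<lambda>r. - g r) (\<lambda>_. 0)"
proof -
  interpret clock_pair T "1 + 1 / \<theta>" \<Lambda> B by (rule clocks[OF T])
  show ?thesis
    unfolding expands_def
  proof (intro allI impI)
    fix \<epsilon> :: real assume \<epsilon>: "\<epsilon> > 0"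
    have "uniformly_continuous_on {0..T} g"
      using g by (intro compact_uniformly_continuous) auto
    then obtain \<delta> where \<delta>: "\<delta> > 0"
      "\<And>x y. \<lbrakk>x \<in> {0..T}; y \<in> {0..T}; dist y x < \<delta>\<rbrakk> \<Longrightarrow> dist (g y) (g x) < \<epsilon>"
      using \<epsilon> unfolding uniformly_continuous_on_def by metis
    show "\<exists>\<delta>>0. \<forall>s r. 0 \<le> s \<and> s \<le> r \<and> r \<le> T \<and> r - s < \<delta> \<longrightarrow>
      \<bar>cum_rate (\<lambda>u. g u * lam u) s - cum_rate (\<lambda>u. g u * lam u) r
        - - g r * (\<Lambda> r - \<Lambda> s) - 0 * (B r - B s)\<bar> \<le> \<epsilon> * (\<Lambda> r - \<Lambda> s)"
    proof (intro exI[of _ \<delta>] conjI allI impI \<delta>(1))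
      fix s r assume "0 \<le> s \<and> s \<le> r \<and> r \<le> T \<and> r - s < \<delta>"
      then have sr: "0 \<le> s" "s \<le> r" "r \<le> T" "r - s < \<delta>" "0 \<le> r" by auto
      have il: "set_integrable lborel {s..r} lam"
        using sr by (intro set_integrable_subset[OF lam_integrable[OF T]]) auto
      have ig: "set_integrable lborel {s..r} (\<lambda>u. g u * lam u)"
        using sr by (intro set_integrable_subset[OF continuous_rate_integrable[OF T g]]) auto
      have dl: "\<Lambda> r - \<Lambda> s = (LBINT u:{s..r}. lam u)"
        using sr by (intro cum_rate_diff lam_integrable) auto
      have dg: "cum_rate (\<lambda>u. g u * lam u) r - cum_rate (\<lambda>u. g u * lam u) s = (LBINT u:{s..r}. g u * lam u)"
        using sr by (intro cum_rate_diff set_integrable_subset[OF continuous_rate_integrable[OF T g]]) auto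
      have close: "\<bar>g u - g r\<bar> \<le> \<epsilon>" if "u \<in> {s..r}" for u
        using \<delta>(2)[of r u] that sr by (auto simp: dist_real_def)
      have up: "(LBINT u:{s..r}. g u * lam u) \<le> (LBINT u:{s..r}. (g r + \<epsilon>) * lam u)"
      proof (intro set_integral_mono ig set_integrable_mult_right il)
        fix u assume "u \<in> {s..r}"
        then show "g u * lam u \<le> (g r + \<epsilon>) * lam u"
          using close[of u] lam_nonneg[of u] sr by (intro mult_right_mono) auto
      qed
      have lo: "(LBINT u:{s..r}. (g r - \<epsilon>) * lam u) \<le> (LBINT u:{s..r}. g u * lam u)"
      proof (intro set_integral_mono ig set_integrable_mult_right il)
        fix u assume "u \<in> {s..r}"
        then show "(g r - \<epsilon>) * lam u \<le> g u * lam u"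
          using close[of u] lam_nonneg[of u] sr by (intro mult_right_mono) auto
      qed
      show "\<bar>cum_rate (\<lambda>u. g u * lam u) s - cum_rate (\<lambda>u. g u * lam u) r
        - - g r * (\<Lambda> r - \<Lambda> s) - 0 * (B r - B s)\<bar> \<le> \<epsilon> * (\<Lambda> r - \<Lambda> s)"
        using up lo dg unfolding set_integral_mult_right dl by (simp add: algebra_simps)
    qed
  qed
qed

text \<open>
  All offspring laws lie on the line through the point mass at \<open>0\<close> and any one of them that differs
  from it: their generating functions do, and these determine the coefficients.
\<close>

lemma offspring_proportional:
  assumes t: "0 \<le> t" "0 \<le> t'"
  shows "a t' * (pmf (p t) j - of_bool (j = 0)) = a t * (pmf (p t') j - of_bool (j = 0))"
proof -
  define d where "d j = a t' * (pmf (p t) j - of_bool (j = 0)) - a t * (pmf (p t') j - of_bool (j = 0))"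
    for j :: nat
  have s1: "summable (\<lambda>j. \<bar>pmf q j - of_bool (j = 0)\<bar>)" for q :: "nat pmf"
  proof -
    have "summable (\<lambda>j. pmf q j + of_bool (j = 0))"
      using pgf_sums[of 1 q] summable_finite[of "{0}" "\<lambda>j::nat. of_bool (j = 0) :: real"]
      by (intro summable_add) (auto simp: sums_iff)
    then show ?thesis
      by (rule summable_comparison_test') (auto simp: abs_le_iff)
  qed
  have "summable (\<lambda>j. \<bar>d j\<bar>)"
  proof (rule summable_comparison_test')
    show "summable (\<lambda>j. \<bar>a t'\<bar> * \<bar>pmf (p t) j - of_bool (j = 0)\<bar> + \<bar>a t\<bar> * \<bar>pmf (p t') j - of_bool (j = 0)\<bar>)"
      by (intro summable_add summable_mult s1)
    show "norm \<bar>d j\<bar> \<le> \<bar>a t'\<bar> * \<bar>pmf (p t) j - of_bool (j = 0)\<bar> + \<bar>a t\<bar> * \<bar>pmf (p t') j - of_bool (j = 0)\<bar>"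
      for j unfolding d_def using abs_triangle_ineq4 by (simp add: abs_mult[symmetric])
  qed
  moreover have "(\<lambda>j. d j * s ^ j) sums 0" if s: "0 < s" "s < 1" for s
  proof -
    have one: "(\<lambda>j. (pmf (p t) j - of_bool (j = 0)) * s ^ j) sums (- (a t * \<phi> (1 - s)))"
      if "0 \<le> t" for t
    proof -
      have "(\<lambda>j. of_bool (j = 0) * s ^ j) sums (1::real)"
        using powser_sums_zero[of "\<lambda>j. 1::real"] sums_single[of 0 "\<lambda>j. s ^ j"]
        by (simp add: of_bool_def if_distrib[of "\<lambda>x. x * _"] cong: if_cong)
      from sums_diff[OF pgf_sums[of s "p t"] this]
      have "(\<lambda>j. (pmf (p t) j - of_bool (j = 0)) * s ^ j) sums (pgf (p t) s - 1)"
        using s by (simp add: left_diff_distrib)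
      moreover have "pgf (p t) s = 1 - a t * (1 - s) + a t / (1 + \<theta>) * (1 - s) powr (1 + \<theta>)"
        using offspring_pgf[of t s] pgf_sums[of s "p t"] that s by (simp add: sums_iff)
      ultimately show ?thesis by (simp add: \<phi>_def algebra_simps)
    qed
    from sums_diff[OF sums_mult[OF one[OF t(1)], of "a t'"] sums_mult[OF one[OF t(2)], of "a t"]]
    show ?thesis by (simp add: d_def algebra_simps)
  qed
  ultimately have "d j = 0" by (rule powser_zero_imp_coeffs_zero)
  then show ?thesis by (simp add: d_def)
qed

text \<open>
  The time dependence of the offspring law is the scalar factor \<open>a t\<close>. Hence \<open>pmf (p t) j\<close> is
  measurable in \<open>t\<close>, its integral against \<open>d\<Lambda>\<close> is a combination of increments of \<open>\<Lambda>\<close> and \<open>B\<close>, and the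
  tails of all the laws are controlled by those of the single sequence \<open>c\<close>. If \<open>a\<close> vanishes
  identically, the laws carry no information about \<open>c\<close>, which explains the first alternative.
\<close>

lemma offspring_shape:
  obtains c :: "nat \<Rightarrow> real" where
    "\<And>t j. 0 \<le> t \<Longrightarrow> pmf (p t) j = of_bool (j = 0) + a t * c j"
    "(\<forall>t\<ge>0. a t = 0) \<or> (\<forall>y. 0 \<le> y \<and> y \<le> 1 \<longrightarrow> (\<lambda>j. c j * y ^ j) sums (- \<phi> (1 - y)))"
proof (cases "\<forall>t\<ge>0. a t = 0")
  case True
  have "pgf (p t) s = 1" if "0 \<le> t" "0 \<le> s" "s \<le> 1" for t s
    using offspring_pgf[of t s] pgf_sums[of s "p t"] that True by (simp add: sums_iff)
  then have p0: "pmf (p t) 0 = 1" if "0 \<le> t" for t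
    using that by (simp flip: pgf_0)
  have "pmf (p t) j = of_bool (j = 0) + a t * 0" if "0 \<le> t" for t j
  proof (cases "j = 0")
    case False
    have "pmf (p t) 0 + pmf (p t) j = measure (measure_pmf (p t)) {0, j}"
      using False by (simp add: measure_measure_pmf_finite)
    also have "\<dots> \<le> 1" by simp
    finally have "pmf (p t) j \<le> 0" using p0[OF that] by simp
    then have "pmf (p t) j = 0" using pmf_nonneg[of "p t" j] by linarith
    then show ?thesis using False by simp
  qed (use p0[OF that] in simp)
  then show thesis using that[of "\<lambda>_. 0"] True by blast
next
  case False
  then obtain t0 where t0: "0 \<le> t0" "a t0 \<noteq> 0" by blast
  define c where "c j = (pmf (p t0) j - of_bool (j = 0)) / a t0" for j :: nat
  show thesis
  proof
    fix t :: real and j :: nat assume "0 \<le> t"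
    then show "pmf (p t) j = of_bool (j = 0) + a t * c j"
      using offspring_proportional[of t t0 j] t0 by (simp add: c_def field_simps)
  next
    have "(\<lambda>j. c j * y ^ j) sums (- \<phi> (1 - y))" if y: "0 \<le> y" "y \<le> 1" for y
    proof -
      have "(\<lambda>j. of_bool (j = 0) * y ^ j) sums (1::real)"
        using sums_single[of 0 "\<lambda>j. y ^ j"]
        by (simp add: of_bool_def if_distrib[of "\<lambda>x. x * _"] cong: if_cong)
      from sums_divide[OF sums_diff[OF pgf_sums[OF y, of "p t0"] this], of "a t0"]
      have "(\<lambda>j. c j * y ^ j) sums ((pgf (p t0) y - 1) / a t0)"
        by (simp add: c_def left_diff_distrib)
      moreover have "pgf (p t0) y = 1 - a t0 * (1 - y) + a t0 / (1 + \<theta>) * (1 - y) powr (1 + \<theta>)"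
        using offspring_pgf[of t0 y] pgf_sums[of y "p t0"] t0 y by (simp add: sums_iff)
      then have "(pgf (p t0) y - 1) / a t0 = - \<phi> (1 - y)"
        using t0 by (simp add: \<phi>_def field_simps)
      ultimately show ?thesis by simp
    qed
    then show "(\<forall>t\<ge>0. a t = 0) \<or> (\<forall>y. 0 \<le> y \<and> y \<le> 1 \<longrightarrow> (\<lambda>j. c j * y ^ j) sums (- \<phi> (1 - y)))"
      by blast
  qed
qed

end

section \<open>The backward equation\<close>

context theta_positive_environment
begin

text \<open>
  \<open>mean_fn\<close> and \<open>V\<close> are defined from the rates alone. That they are the mean of the process and
  the function \<open>bp_V\<close> follows only from the solution of the backward equation.
\<close>

definition mean_fn :: "real \<Rightarrow> real" where "mean_fn t = exp (B t - \<Lambda> t)"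

definition V :: "real \<Rightarrow> real" where
  "V t = \<theta> / (1 + \<theta>) * cum_rate (\<lambda>u. mean_fn u powr (- \<theta>) * lam u) t"

lemma mean_fn_pos: "0 < mean_fn t"
  by (simp add: mean_fn_def)

lemma mean_fn_powr: "mean_fn t powr (- \<theta>) = exp (\<theta> * \<Lambda> t + (- \<theta>) * B t)"
  by (simp add: mean_fn_def powr_def algebra_simps)

end

context theta_positive_bpve
begin

lemma pgf_K:
  assumes "0 \<le> s" "s \<le> t" "0 \<le> x" "x \<le> 1"
  shows "pgf (K s t n) x = pgf (K s t 1) x ^ n"
  using pgf_sum_replicate[OF assms(3,4)] branching[OF assms(1,2), of n] by simp

text \<open>
  The composition law of branching processes, from the Chapman--Kolmogorov equation and the
  independence of the individuals alive at time \<open>t\<close>.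
\<close>

lemma pgf_semigroup:
  assumes "0 \<le> s" "s \<le> t" "t \<le> u" "0 \<le> x" "x \<le> 1"
  shows "pgf (K s u 1) x = pgf (K s t 1) (pgf (K t u 1) x)"
proof -
  have "pgf (K s u 1) x = measure_pmf.expectation (K s t 1) (\<lambda>n. pgf (K t u n) x)"
    using assms by (simp add: chapman_kolmogorov[of s t u] pgf_bind)
  also have "\<dots> = measure_pmf.expectation (K s t 1) (\<lambda>n. pgf (K t u 1) x ^ n)"
    using assms by (intro Bochner_Integration.integral_cong pgf_K) auto
  finally show ?thesis by (simp add: pgf_def)
qed

lemma death_integral:
  assumes c: "\<And>t j. 0 \<le> t \<Longrightarrow> pmf (p t) j = of_bool (j = 0) + a t * c j"
    and sr: "0 \<le> s" "s \<le> r"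
  shows "(LBINT u:{s..r}. lam u * pmf (p u) j) = of_bool (j = 0) * (\<Lambda> r - \<Lambda> s) + c j * (B r - B s)"
proof -
  have "(LBINT u:{s..r}. lam u * pmf (p u) j)
      = (LBINT u:{s..r}. of_bool (j = 0) * lam u + c j * (lam u * a u))"
    using sr by (intro set_lebesgue_integral_cong) (auto simp: c algebra_simps)
  also have "\<dots> = (LBINT u:{s..r}. of_bool (j = 0) * lam u) + (LBINT u:{s..r}. c j * (lam u * a u))"
  proof (rule set_integral_add)
    have "set_integrable lborel {s..r} lam"
      using sr by (intro set_integrable_subset[OF lam_integrable[of r]]) auto
    then show "set_integrable lborel {s..r} (\<lambda>u. of_bool (j = 0) * lam u)"
      by (rule set_integrable_mult_right)
    have "set_integrable lborel {s..r} (\<lambda>u. lam u * a u)"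
      using sr by (intro set_integrable_subset[OF birth_integrable[of r]]) auto
    then show "set_integrable lborel {s..r} (\<lambda>u. c j * (lam u * a u))"
      by (rule set_integrable_mult_right)
  qed
  also have "\<dots> = of_bool (j = 0) * (LBINT u:{s..r}. lam u) + c j * (LBINT u:{s..r}. lam u * a u)"
    unfolding set_integral_mult_right ..
  also have "(LBINT u:{s..r}. lam u) = \<Lambda> r - \<Lambda> s"
    using sr by (intro cum_rate_diff[symmetric] lam_integrable) auto
  also have "(LBINT u:{s..r}. lam u * a u) = B r - B s"
    unfolding B_def using sr by (intro cum_rate_diff[symmetric] birth_integrable) auto
  finally show ?thesis .
qed

lemma uniform_small_time:
  assumes "\<And>j. j < (N::nat) \<Longrightarrow> \<exists>\<delta>>0. \<forall>s t. 0 \<le> s \<and> s \<le> t \<and> t \<le> T \<and> t - s < \<delta> \<longrightarrow> Q j s t"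
  shows "\<exists>\<delta>>0. \<forall>j<N. \<forall>s t. 0 \<le> s \<and> s \<le> t \<and> t \<le> T \<and> t - s < (\<delta>::real) \<longrightarrow> Q j s t"
  using assms
proof (induction N)
  case 0
  then show ?case by (intro exI[of _ 1]) auto
next
  case (Suc N)
  obtain \<delta> where \<delta>: "\<delta> > 0" "\<forall>j<N. \<forall>s t. 0 \<le> s \<and> s \<le> t \<and> t \<le> T \<and> t - s < \<delta> \<longrightarrow> Q j s t"
    using Suc.IH Suc.prems less_SucI by blast
  obtain \<delta>' where \<delta>': "\<delta>' > 0" "\<forall>s t. 0 \<le> s \<and> s \<le> t \<and> t \<le> T \<and> t - s < \<delta>' \<longrightarrow> Q N s t"
    using Suc.prems[of N] by blast
  show ?case
    using \<delta> \<delta>' by (intro exI[of _ "min \<delta> \<delta>'"]) (auto simp: less_Suc_eq)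
qed

text \<open>
  The backward equation over one short interval, uniformly in the argument \<open>y\<close> of the generating
  function. The uniformity matters because \<open>y\<close> will be the generating function of the remaining
  interval, which changes with \<open>r\<close>. The assumptions control each probability separately; as the
  approximating weights \<open>D\<close> have total mass \<open>1\<close> and tails that are uniformly small relative to
  \<open>\<Lambda> r - \<Lambda> s\<close>, Scheffe's argument carries the control over to the generating functions.
\<close>

lemma short_time_pgf:
  assumes T: "0 \<le> T" and \<epsilon>: "0 < \<epsilon>"
  shows "\<exists>\<delta>>0. \<forall>s r. 0 \<le> s \<and> s \<le> r \<and> r \<le> T \<and> r - s < \<delta> \<longrightarrow> (\<forall>y. 0 \<le> y \<and> y \<le> 1 \<longrightarrow>
    \<bar>(1 - pgf (K s r 1) y) - (1 - y) + (1 - y) * (\<Lambda> r - \<Lambda> s) - \<phi> (1 - y) * (B r - B s)\<bar>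
      \<le> \<epsilon> * (\<Lambda> r - \<Lambda> s))"
proof -
  obtain c :: "nat \<Rightarrow> real" where c: "\<And>t j. 0 \<le> t \<Longrightarrow> pmf (p t) j = of_bool (j = 0) + a t * c j"
    and c_sums: "(\<forall>t\<ge>0. a t = 0) \<or> (\<forall>y. 0 \<le> y \<and> y \<le> 1 \<longrightarrow> (\<lambda>j. c j * y ^ j) sums (- \<phi> (1 - y)))"
    by (rule offspring_shape) blast
  have B_zero: "B t = 0" if "\<forall>t\<ge>0. a t = 0" "0 \<le> t" for t
    using that unfolding B_def cum_rate_def set_lebesgue_integral_def
    by (intro integral_eq_zero_AE always_eventually) (auto simp: indicator_def)
  have B_sums: "(\<lambda>j. c j * y ^ j * (B r - B s)) sums (- \<phi> (1 - y) * (B r - B s))"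
    if "0 \<le> s" "s \<le> r" "0 \<le> y" "y \<le> 1" for s r y
    using c_sums
  proof
    assume "\<forall>t\<ge>0. a t = 0"
    then show ?thesis using that by (simp add: B_zero)
  next
    assume "\<forall>y. 0 \<le> y \<and> y \<le> 1 \<longrightarrow> (\<lambda>j. c j * y ^ j) sums (- \<phi> (1 - y))"
    then show ?thesis using that by (intro sums_mult2) auto
  qed
  define C where "C = 1 + 1 / \<theta>"
  have C: "0 < C" using theta_pos by (simp add: C_def add_pos_pos)
  define \<eta> where "\<eta> = \<epsilon> / 4"
  have \<eta>: "0 < \<eta>" using \<epsilon> by (simp add: \<eta>_def)
  (* N \<ge> 2 keeps the exceptional indices 0 (no offspring) and 1 (no death) out of the tail, where
     the approximating weights defined below are c j * (B r - B s). *)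
  obtain N where N: "2 \<le> N" "\<And>s r. \<lbrakk>0 \<le> s; s \<le> r\<rbrakk> \<Longrightarrow> (\<Sum>j. c (j + N)) * (B r - B s) \<le> \<eta> * (\<Lambda> r - \<Lambda> s)"
  proof (cases "\<forall>t\<ge>0. a t = 0")
    case True
    then show thesis using \<eta> \<Lambda>_mono by (intro that[of 2]) (auto simp: B_zero)
  next
    case False
    then have "summable c" using c_sums by (auto simp: sums_iff dest: spec[of _ 1])
    then have "(\<lambda>n. \<Sum>j. c (j + n)) \<longlonglongrightarrow> 0"
      by (rule suminf_exist_split2)
    then have "eventually (\<lambda>n. (\<Sum>j. c (j + n)) < \<eta> / C) sequentially"
      using \<eta> C by (intro order_tendstoD(2)[of _ 0]) auto
    then have "eventually (\<lambda>n. (\<Sum>j. c (j + n)) < \<eta> / C \<and> 2 \<le> n) sequentially"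
      using eventually_ge_at_top[of 2] by eventually_elim simp
    then obtain N where N: "(\<Sum>j. c (j + N)) < \<eta> / C" "2 \<le> N"
      unfolding eventually_sequentially by blast
    have "(\<Sum>j. c (j + N)) * (B r - B s) \<le> \<eta> * (\<Lambda> r - \<Lambda> s)" if "0 \<le> s" "s \<le> r" for s r
    proof -
      have "(\<Sum>j. c (j + N)) * (B r - B s) \<le> \<eta> / C * (B r - B s)"
        using N B_increment[OF that] by (intro mult_right_mono) auto
      also have "\<dots> \<le> \<eta> / C * (C * (\<Lambda> r - \<Lambda> s))"
        using \<eta> C B_increment[OF that] by (intro mult_left_mono) (auto simp: C_def)
      finally show ?thesis using C by simp
    qed
    then show thesis using N(2) by (intro that)
  qed
  (* The first-order approximation of the law of the population at time r started from one
     individual at time s. *)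
  define D where "D s r j = of_bool (j = 1) * (1 - (\<Lambda> r - \<Lambda> s))
      + (of_bool (j = 0) * (\<Lambda> r - \<Lambda> s) + c j * (B r - B s))" for s r and j :: nat
  have D_eq: "D s r j = of_bool (j = 1) * (1 - (\<Lambda> r - \<Lambda> s)) + (LBINT u:{s..r}. lam u * pmf (p u) j)"
    if "0 \<le> s" "s \<le> r" for s r j
    using death_integral[OF c that, of j] by (simp add: D_def)
  have "\<exists>\<delta>>0. \<forall>j<N. \<forall>s r. 0 \<le> s \<and> s \<le> r \<and> r \<le> T \<and> r - s < \<delta> \<longrightarrow>
      \<bar>pmf (K s r 1) j - D s r j\<bar> \<le> \<eta> / N * (\<Lambda> r - \<Lambda> s)"
  proof (rule uniform_small_time)
    fix j assume "j < N"
    then have pos: "0 < \<eta> / N" using \<eta> by simp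
    show "\<exists>\<delta>>0. \<forall>s r. 0 \<le> s \<and> s \<le> r \<and> r \<le> T \<and> r - s < \<delta> \<longrightarrow>
      \<bar>pmf (K s r 1) j - D s r j\<bar> \<le> \<eta> / N * (\<Lambda> r - \<Lambda> s)"
    proof (cases "j = 1")
      case True
      have z: "(LBINT u:{s..r}. lam u * pmf (p u) 1) = 0" if "0 \<le> s" for s r
        using that unfolding set_lebesgue_integral_def
        by (intro integral_eq_zero_AE always_eventually) (auto simp: indicator_def no_single_offspring simp del: One_nat_def)
      show ?thesis using no_death[OF T pos] True by (simp add: D_eq z[simplified] cong: conj_cong imp_cong)
    next
      case False
      then show ?thesis using death[OF T pos False] by (simp add: D_eq cong: conj_cong imp_cong)
    qed
  qed
  then obtain \<delta> where \<delta>: "\<delta> > 0" "\<And>j s r. \<lbrakk>j < N; 0 \<le> s; s \<le> r; r \<le> T; r - s < \<delta>\<rbrakk> \<Longrightarrow>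
      \<bar>pmf (K s r 1) j - D s r j\<bar> \<le> \<eta> / N * (\<Lambda> r - \<Lambda> s)"
    by blast
  show ?thesis
  proof (intro exI[of _ \<delta>] conjI allI impI \<delta>(1))
    fix s r y :: real
    assume "0 \<le> s \<and> s \<le> r \<and> r \<le> T \<and> r - s < \<delta>" and "0 \<le> y \<and> y \<le> 1"
    then have sr: "0 \<le> s" "s \<le> r" "r \<le> T" "r - s < \<delta>" and y: "0 \<le> y" "y \<le> 1" by auto
    have D_sums: "(\<lambda>j. D s r j * x ^ j) sums
        (x * (1 - (\<Lambda> r - \<Lambda> s)) + ((\<Lambda> r - \<Lambda> s) - \<phi> (1 - x) * (B r - B s)))"
      if x: "0 \<le> x" "x \<le> 1" for x
    proof -
      have eq: "of_bool (j = 1) * (1 - (\<Lambda> r - \<Lambda> s)) * x ^ j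
          = (if j = 1 then (1 - (\<Lambda> r - \<Lambda> s)) * x ^ j else 0)" for j :: nat
        by simp
      have "(\<lambda>j. of_bool (j = 1) * (1 - (\<Lambda> r - \<Lambda> s)) * x ^ j) sums (x * (1 - (\<Lambda> r - \<Lambda> s)))"
        unfolding eq using sums_single[of 1 "\<lambda>j. (1 - (\<Lambda> r - \<Lambda> s)) * x ^ j"]
        by (simp only: power_one_right mult.commute)
      moreover have "(\<lambda>j. of_bool (j = 0) * (\<Lambda> r - \<Lambda> s) * x ^ j) sums (\<Lambda> r - \<Lambda> s)"
        using sums_single[of 0 "\<lambda>j. (\<Lambda> r - \<Lambda> s) * x ^ j"]
        by (simp add: of_bool_def if_distrib[of "\<lambda>x. x * _"] cong: if_cong)
      ultimately have "(\<lambda>j. of_bool (j = 1) * (1 - (\<Lambda> r - \<Lambda> s)) * x ^ j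
          + (of_bool (j = 0) * (\<Lambda> r - \<Lambda> s) * x ^ j + c j * x ^ j * (B r - B s)))
        sums (x * (1 - (\<Lambda> r - \<Lambda> s)) + ((\<Lambda> r - \<Lambda> s) + (- \<phi> (1 - x) * (B r - B s))))"
        by (intro sums_add B_sums sr x)
      then show ?thesis by (simp add: D_def algebra_simps)
    qed
    have "\<bar>pgf (K s r 1) y - (y * (1 - (\<Lambda> r - \<Lambda> s)) + ((\<Lambda> r - \<Lambda> s) - \<phi> (1 - y) * (B r - B s)))\<bar>
        \<le> 4 * (\<eta> * (\<Lambda> r - \<Lambda> s))"
    proof (rule scheffe_powers[where K = "pmf (K s r 1)" and D = "D s r" and w = "\<lambda>j. y ^ j" and N = N])
      show "pmf (K s r 1) sums 1"
        using pgf_sums[of 1 "K s r 1"] by (simp add: pgf_at_1)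
      show "D s r sums 1"
        using D_sums[of 1] theta_pos by (simp add: \<phi>_def)
      show "0 \<le> D s r j" if "N \<le> j" for j
      proof -
        have "0 \<le> (LBINT u:{s..r}. lam u * pmf (p u) j)"
          unfolding set_lebesgue_integral_def
          using sr lam_nonneg by (intro integral_nonneg_AE always_eventually) (auto split: split_indicator)
        then show ?thesis using D_eq[of s r j] sr that N(1) by simp
      qed
      show "\<bar>y ^ j\<bar> \<le> 1" for j using y by (simp add: power_le_one)
      have "(\<Sum>j<N. \<bar>pmf (K s r 1) j - D s r j\<bar>) \<le> (\<Sum>j<N. \<eta> / N * (\<Lambda> r - \<Lambda> s))"
        using sr by (intro sum_mono \<delta>(2)) auto
      also have "\<dots> = \<eta> * (\<Lambda> r - \<Lambda> s)" using N(1) by simp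
      finally show "(\<Sum>j<N. \<bar>pmf (K s r 1) j - D s r j\<bar>) \<le> \<eta> * (\<Lambda> r - \<Lambda> s)" .
      have "(\<Sum>j. D s r (j + N)) = (\<Sum>j. c (j + N) * (B r - B s))"
        using N(1) by (simp add: D_def)
      also have "\<dots> \<le> \<eta> * (\<Lambda> r - \<Lambda> s)"
      proof (cases "B r - B s = 0")
        case True
        then show ?thesis using \<eta> \<Lambda>_mono sr by simp
      next
        case False
        have "summable (\<lambda>j. c j * (B r - B s))"
          using B_sums[OF sr(1,2), of 1] by (simp add: sums_iff)
        then have "summable c" using summable_divide[of _ "B r - B s"] False by fastforce
        then have "(\<Sum>j. c (j + N) * (B r - B s)) = (\<Sum>j. c (j + N)) * (B r - B s)"
          by (intro suminf_mult2[symmetric]) (simp add: summable_iff_shift)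
        then show ?thesis using N(2)[OF sr(1,2)] by simp
      qed
      finally show "(\<Sum>j. D s r (j + N)) \<le> \<eta> * (\<Lambda> r - \<Lambda> s)" .
      show "(\<lambda>j. pmf (K s r 1) j * y ^ j) sums pgf (K s r 1) y" by (rule pgf_sums[OF y])
      show "(\<lambda>j. D s r j * y ^ j) sums
        (y * (1 - (\<Lambda> r - \<Lambda> s)) + ((\<Lambda> r - \<Lambda> s) - \<phi> (1 - y) * (B r - B s)))"
        by (rule D_sums[OF y])
    qed simp
    then show "\<bar>(1 - pgf (K s r 1) y) - (1 - y) + (1 - y) * (\<Lambda> r - \<Lambda> s) - \<phi> (1 - y) * (B r - B s)\<bar>
      \<le> \<epsilon> * (\<Lambda> r - \<Lambda> s)"
      by (simp add: \<eta>_def algebra_simps abs_minus_commute)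
  qed
qed

lemma expands_survival:
  assumes T: "0 \<le> T" and x: "0 \<le> x" "x \<le> 1"
  defines "G \<equiv> \<lambda>s. 1 - pgf (K s T 1) x"
  shows "clock_pair.expands T \<Lambda> B G (\<lambda>s. - G s) (\<lambda>s. \<phi> (G s))"
proof -
  interpret clock_pair T "1 + 1 / \<theta>" \<Lambda> B by (rule clocks[OF T])
  show ?thesis
    unfolding expands_def
  proof (intro allI impI)
    fix \<epsilon> :: real assume "\<epsilon> > 0"
    from short_time_pgf[OF T this] obtain \<delta> where \<delta>: "\<delta> > 0"
      "\<And>s r y. \<lbrakk>0 \<le> s; s \<le> r; r \<le> T; r - s < \<delta>; 0 \<le> y; y \<le> 1\<rbrakk> \<Longrightarrow>
        \<bar>(1 - pgf (K s r 1) y) - (1 - y) + (1 - y) * (\<Lambda> r - \<Lambda> s) - \<phi> (1 - y) * (B r - B s)\<bar>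
        \<le> \<epsilon> * (\<Lambda> r - \<Lambda> s)"
      by blast
    show "\<exists>\<delta>>0. \<forall>s r. 0 \<le> s \<and> s \<le> r \<and> r \<le> T \<and> r - s < \<delta> \<longrightarrow>
      \<bar>G s - G r - - G r * (\<Lambda> r - \<Lambda> s) - \<phi> (G r) * (B r - B s)\<bar> \<le> \<epsilon> * (\<Lambda> r - \<Lambda> s)"
    proof (intro exI[of _ \<delta>] conjI allI impI \<delta>(1))
      fix s r assume sr: "0 \<le> s \<and> s \<le> r \<and> r \<le> T \<and> r - s < \<delta>"
      have "1 - pgf (K s r 1) (pgf (K r T 1) x) = G s"
        using pgf_semigroup[of s r T x] x sr by (simp add: G_def)
      moreover have "1 - pgf (K r T 1) x = G r" by (simp add: G_def)
      ultimately show "\<bar>G s - G r - - G r * (\<Lambda> r - \<Lambda> s) - \<phi> (G r) * (B r - B s)\<bar> \<le> \<epsilon> * (\<Lambda> r - \<Lambda> s)"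
        using \<delta>(2)[of s r "pgf (K r T 1) x"] x sr by (simp add: pgf_nonneg pgf_le_1)
    qed
  qed
qed

text \<open>
  \<open>G\<close> must stay away from \<open>0\<close>, where \<open>G\<^sup>-\<^sup>\<theta>\<close> is singular. For this it is enough that the population
  can be \<open>1\<close> at time \<open>T\<close>: over a short interval this has probability at least \<open>1 / 2\<close>, and
  finitely many such intervals cover \<open>[s, T]\<close>.
\<close>

lemma staying_single_bounded_below:
  assumes T: "0 \<le> T"
  obtains c where "0 < c" "\<And>s. \<lbrakk>0 \<le> s; s \<le> T\<rbrakk> \<Longrightarrow> c \<le> pmf (K s T 1) 1"
proof -
  interpret clock_pair T "1 + 1 / \<theta>" \<Lambda> B by (rule clocks[OF T])
  obtain \<delta>1 where \<delta>1: "\<delta>1 > 0" "\<And>s t. \<lbrakk>0 \<le> s; s \<le> t; t \<le> T; t - s < \<delta>1\<rbrakk> \<Longrightarrow>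
      \<bar>pmf (K s t 1) 1 - (1 - (\<Lambda> t - \<Lambda> s))\<bar> \<le> 1 * (\<Lambda> t - \<Lambda> s)"
    using no_death[OF T, of 1] by auto
  obtain \<delta>2 where \<delta>2: "\<delta>2 > 0" "\<And>s t. \<lbrakk>0 \<le> s; s \<le> t; t \<le> T; t - s < \<delta>2\<rbrakk> \<Longrightarrow> \<Lambda> t - \<Lambda> s < 1 / 4"
    by (rule clock_small[of "1 / 4"]) auto
  define \<delta> where "\<delta> = min \<delta>1 \<delta>2"
  have \<delta>: "0 < \<delta>" using \<delta>1 \<delta>2 by (simp add: \<delta>_def)
  have half: "1 / 2 \<le> pmf (K s t 1) 1" if "0 \<le> s" "s \<le> t" "t \<le> T" "t - s < \<delta>" for s t
    using \<delta>1(2)[of s t] \<delta>2(2)[of s t] that by (simp add: \<delta>_def abs_le_iff)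
  have mult: "pmf (K s t 1) 1 * pmf (K t u 1) 1 \<le> pmf (K s u 1) 1" if "0 \<le> s" "s \<le> t" "t \<le> u" for s t u
  proof -
    have "pmf (K s t 1) 1 * pmf (K t u 1) 1
        = measure_pmf.expectation (K s t 1) (\<lambda>n. pmf (K t u 1) 1 * indicator {1} n)"
      by (simp add: measure_pmf_single)
    also have "\<dots> \<le> measure_pmf.expectation (K s t 1) (\<lambda>n. pmf (K t u n) 1)"
    proof (rule integral_mono)
      show "integrable (measure_pmf (K s t 1)) (\<lambda>n. pmf (K t u 1) 1 * indicator {1} n)"
        by (intro measure_pmf.integrable_const_bound[where B = 1])
          (auto simp: pmf_le_1 split: split_indicator)
      show "integrable (measure_pmf (K s t 1)) (\<lambda>n. pmf (K t u n) 1)"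
        by (intro measure_pmf.integrable_const_bound[where B = 1]) (auto simp: pmf_le_1)
    qed (auto split: split_indicator)
    also have "\<dots> = pmf (K s u 1) 1"
      using that by (simp add: chapman_kolmogorov[of s t u] pmf_bind)
    finally show ?thesis .
  qed
  have step: "(1 / 2) ^ Suc n \<le> pmf (K s T 1) 1"
    if "0 \<le> s" "s \<le> r" "r \<le> T" "r - s < \<delta>" "(1 / 2) ^ n \<le> pmf (K r T 1) 1" for n s r
  proof -
    have "1 / 2 * (1 / 2) ^ n \<le> pmf (K s r 1) 1 * pmf (K r T 1) 1"
      using half[OF that(1-4)] that(5) by (intro mult_mono) auto
    also have "\<dots> \<le> pmf (K s T 1) 1"
      using that by (intro mult) auto
    finally show ?thesis by simp
  qed
  have "(1 / 2) ^ 0 \<le> pmf (K T T 1) 1" using T by (simp add: transition_refl)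
  then have "\<exists>N. \<forall>s. 0 \<le> s \<and> s \<le> T \<longrightarrow> (1 / 2) ^ N \<le> pmf (K s T 1) 1"
    by (rule backward_induct_steps[where P = "\<lambda>n s. (1 / 2) ^ n \<le> pmf (K s T 1) 1", OF _ \<delta> step])
  then obtain N where N: "\<forall>s. 0 \<le> s \<and> s \<le> T \<longrightarrow> (1 / 2) ^ N \<le> pmf (K s T 1) 1" by blast
  show thesis
    by (rule that[of "(1 / 2) ^ N"]) (use N in auto)
qed

text \<open>
  The solution of the backward equation. Its Bernoulli form suggests \<open>ln G\<close>: in the expansion of
  \<open>Y = - \<theta> ln G + \<theta> (\<Lambda> - B)\<close> the coefficient of \<open>\<Lambda>\<close> cancels. Then \<open>exp Y = G\<^sup>-\<^sup>\<theta> \<mu>\<^sup>-\<^sup>\<theta>\<close> has an expansion in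
  which \<open>G\<close> no longer occurs, and it is balanced by those of \<open>V\<close> and of \<open>\<mu>\<^sup>-\<^sup>\<theta>\<close>.
\<close>

lemma survival_pgf_formula:
  assumes T: "0 \<le> T" and x: "0 \<le> x" "x < 1"
  shows "(1 - pgf (K 0 T 1) x) powr (- \<theta>)
    = V T + 1 / (1 + \<theta>) + mean_fn T powr (- \<theta>) * ((1 - x) powr (- \<theta>) - 1 / (1 + \<theta>))"
proof -
  interpret clock_pair T "1 + 1 / \<theta>" \<Lambda> B by (rule clocks[OF T])
  define G where "G s = 1 - pgf (K s T 1) x" for s
  define X where "X s = \<theta> * \<Lambda> s + (- \<theta>) * B s" for s
  define E where "E s = exp (X s)" for s
  define Y where "Y s = (- \<theta>) * ln (G s) + X s" for s
  obtain c where c: "0 < c" "\<And>s. \<lbrakk>0 \<le> s; s \<le> T\<rbrakk> \<Longrightarrow> c \<le> pmf (K s T 1) 1"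
    by (rule staying_single_bounded_below[OF T]) blast
  define l where "l = c * (1 - x)"
  have l: "0 < l" using c x by (simp add: l_def)
  have G_range: "G s \<in> {l..1}" if "0 \<le> s" "s \<le> T" for s
  proof -
    have "l \<le> pmf (K s T 1) 1 * (1 - x)"
      unfolding l_def using c(2)[OF that] x by (intro mult_right_mono) auto
    also have "\<dots> \<le> G s"
      unfolding G_def using x by (intro one_minus_pgf_ge) auto
    finally show ?thesis using x by (simp add: G_def pgf_nonneg)
  qed
  have G_pos: "0 < G s" if "0 \<le> s" "s \<le> T" for s
    using G_range[OF that] l by auto
  have \<phi>_bound: "\<bar>\<phi> g\<bar> \<le> 1" if "0 < g" "g \<le> 1" for g
  proof -
    have "g powr (1 + \<theta>) \<le> 1 powr (1 + \<theta>)" using that theta_pos by (intro powr_mono2) auto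
    then have "g powr (1 + \<theta>) \<le> 1" by simp
    moreover have "0 \<le> g powr (1 + \<theta>) / (1 + \<theta>)" using theta_pos by simp
    moreover have "g powr (1 + \<theta>) / (1 + \<theta>) \<le> g powr (1 + \<theta>)"
      using theta_pos by (simp add: field_simps)
    ultimately show ?thesis using that by (simp add: \<phi>_def abs_le_iff)
  qed
  have eG: "expands G (\<lambda>s. - G s) (\<lambda>s. \<phi> (G s))"
    unfolding G_def using x by (intro expands_survival[OF T]) auto
  have "expands (\<lambda>s. ln (G s)) (\<lambda>s. inverse (G s) * - G s) (\<lambda>s. inverse (G s) * \<phi> (G s))"
  proof (rule expands_compose[OF eG G_range, where c = 1])
    show "continuous_on {l..1} inverse" using l by (intro continuous_intros) auto
    show "(ln has_field_derivative inverse g) (at g)" if "g \<in> {l..1}" for g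
      using that l by (intro DERIV_ln) auto
    show "\<bar>- G s\<bar> \<le> 1 \<and> \<bar>\<phi> (G s)\<bar> \<le> 1" if "0 \<le> s" "s \<le> T" for s
      using G_range[OF that] l \<phi>_bound[of "G s"] by auto
  qed auto
  note e_ln = this
  have eX: "expands X (\<lambda>_. - \<theta>) (\<lambda>_. \<theta>)"
    using expands_linear_clocks[of \<theta> "- \<theta>"] by (simp add: X_def [abs_def])
  have X_range: "X s \<in> {- (\<theta> * B T)..\<theta> * \<Lambda> T}" if "0 \<le> s" "s \<le> T" for s
  proof -
    have "0 \<le> B s" "B s \<le> B T" "0 \<le> \<Lambda> s" "\<Lambda> s \<le> \<Lambda> T"
      using B_increment(1)[of 0 s] B_increment(1)[of s T] \<Lambda>_mono[of 0 s] \<Lambda>_mono[of s T] that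
      by (auto simp: B_def cum_rate_0)
    then have "0 \<le> \<theta> * B s" "\<theta> * B s \<le> \<theta> * B T" "0 \<le> \<theta> * \<Lambda> s" "\<theta> * \<Lambda> s \<le> \<theta> * \<Lambda> T"
      using theta_pos by auto
    then show ?thesis by (simp add: X_def)
  qed
  have eE: "expands E (\<lambda>s. E s * - \<theta>) (\<lambda>s. E s * \<theta>)"
    unfolding E_def
    by (rule expands_compose[OF eX X_range, where c = \<theta>])
      (use theta_pos in \<open>auto intro!: continuous_intros DERIV_exp\<close>)
  (* The term inverse (G s) * \<phi> (G s) = 1 - G s powr \<theta> / (1 + \<theta>) leaves only the power of G. *)
  have eY: "expands Y (\<lambda>_. 0) (\<lambda>s. \<theta> / (1 + \<theta>) * G s powr \<theta>)"
  proof (rule expands_cong[OF expands_add[OF expands_cmult[OF e_ln, of "- \<theta>"] eX]])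
    fix s assume s: "0 \<le> s" "s \<le> T"
    show "- \<theta> * ln (G s) + X s = Y s" by (simp add: Y_def)
    show "- \<theta> * (inverse (G s) * - G s) + - \<theta> = 0"
      using G_pos[OF s] by simp
    have "inverse (G s) * \<phi> (G s) = 1 - G s powr \<theta> / (1 + \<theta>)"
      using G_pos[OF s] by (simp add: \<phi>_def powr_add field_simps)
    then show "- \<theta> * (inverse (G s) * \<phi> (G s)) + \<theta> = \<theta> / (1 + \<theta>) * G s powr \<theta>"
      by (simp only:) (simp add: algebra_simps)
  qed
  have Y_range: "Y s \<in> {- (\<theta> * B T)..\<theta> * \<Lambda> T - \<theta> * ln l}" if s: "0 \<le> s" "s \<le> T" for s
  proof -
    have "ln l \<le> ln (G s)" "ln (G s) \<le> 0" using G_range[OF s] l by auto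
    then have "\<theta> * ln l \<le> \<theta> * ln (G s)" "\<theta> * ln (G s) \<le> 0"
      using theta_pos by (auto simp: mult_le_0_iff)
    then show ?thesis using X_range[OF s] by (simp add: Y_def)
  qed
  have "expands (\<lambda>s. exp (Y s)) (\<lambda>s. exp (Y s) * 0) (\<lambda>s. exp (Y s) * (\<theta> / (1 + \<theta>) * G s powr \<theta>))"
  proof (rule expands_compose[OF eY Y_range, where c = 1])
    show "\<bar>0\<bar> \<le> (1::real) \<and> \<bar>\<theta> / (1 + \<theta>) * G s powr \<theta>\<bar> \<le> 1" if "0 \<le> s" "s \<le> T" for s
    proof -
      have "G s powr \<theta> \<le> 1 powr \<theta>"
        using G_range[OF that] l theta_pos by (intro powr_mono2) auto
      then have "\<theta> / (1 + \<theta>) * G s powr \<theta> \<le> 1 * 1"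
        using theta_pos by (intro mult_mono) auto
      then show ?thesis using theta_pos by simp
    qed
  qed (auto intro!: continuous_intros DERIV_exp)
  note e_exp = this
  have expY: "exp (Y s) = G s powr (- \<theta>) * E s" if "0 \<le> s" "s \<le> T" for s
    using G_pos[OF that] by (simp add: Y_def E_def powr_def flip: exp_add)
  have E_eq: "mean_fn s powr (- \<theta>) = E s" for s
    by (simp add: mean_fn_powr E_def X_def)
  have "continuous_on {0..T} E"
    unfolding E_def X_def
    by (intro continuous_intros B_continuous T cum_rate_continuous lam_integrable)
  from expands_cmult[OF expands_integral[OF T this], of "\<theta> / (1 + \<theta>)"]
  have eV: "expands V (\<lambda>s. \<theta> / (1 + \<theta>) * - E s) (\<lambda>s. \<theta> / (1 + \<theta>) * 0)"
    by (simp add: V_def [abs_def] E_eq)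
  have "expands (\<lambda>s. exp (Y s) + (V s + - 1 / (1 + \<theta>) * E s)) (\<lambda>_. 0) (\<lambda>_. 0)"
  proof (rule expands_cong[OF expands_add[OF e_exp expands_add[OF eV expands_cmult[OF eE, of "- 1 / (1 + \<theta>)"]]]])
    fix s assume s: "0 \<le> s" "s \<le> T"
    show "exp (Y s) * 0 + (\<theta> / (1 + \<theta>) * - E s + - 1 / (1 + \<theta>) * (E s * - \<theta>)) = 0"
      by simp
    have "exp (Y s) * (\<theta> / (1 + \<theta>) * G s powr \<theta>) = \<theta> / (1 + \<theta>) * E s"
      using G_pos[OF s] by (simp add: expY[OF s] powr_minus field_simps)
    then show "exp (Y s) * (\<theta> / (1 + \<theta>) * G s powr \<theta>)
        + (\<theta> / (1 + \<theta>) * 0 + - 1 / (1 + \<theta>) * (E s * \<theta>)) = 0"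
      by simp
  qed simp
  then have "exp (Y 0) + (V 0 + - 1 / (1 + \<theta>) * E 0) = exp (Y T) + (V T + - 1 / (1 + \<theta>) * E T)"
    by (rule expands_zero_imp_const)
  moreover have "E 0 = 1" "V 0 = 0"
    by (simp_all add: E_def X_def V_def B_def cum_rate_0)
  moreover have "G T = 1 - x"
    using T x by (simp add: G_def transition_refl pgf_return)
  ultimately have "G 0 powr (- \<theta>) + - 1 / (1 + \<theta>) = (1 - x) powr (- \<theta>) * E T + (V T + - 1 / (1 + \<theta>) * E T)"
    using expY[of 0] expY[of T] T by simp
  then show ?thesis
    by (simp add: G_def E_eq algebra_simps)
qed

end

section \<open>Moments of the process\<close>

lemma (in prob_space) integral_uniform_measure:
  fixes f :: "'a \<Rightarrow> real"
  assumes A: "A \<in> events" "0 < prob A" and f: "f \<in> borel_measurable M"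
  shows "(LINT \<omega>|uniform_measure M A. f \<omega>) = (LINT \<omega>|M. indicator A \<omega> * f \<omega>) / prob A"
proof -
  have "uniform_measure M A = density M (\<lambda>\<omega>. ennreal (indicator A \<omega> / prob A))"
    unfolding uniform_measure_def
  proof (rule arg_cong[where f = "density M"], rule ext)
    fix \<omega>
    show "indicator A \<omega> / emeasure M A = ennreal (indicator A \<omega> / prob A)"
      using A by (auto simp: emeasure_eq_measure divide_ennreal[symmetric] split: split_indicator)
  qed
  then have "(LINT \<omega>|uniform_measure M A. f \<omega>) = (LINT \<omega>|M. (indicator A \<omega> / prob A) *\<^sub>R f \<omega>)"
    using A f by (simp add: integral_density)
  also have "\<dots> = (LINT \<omega>|M. indicator A \<omega> * f \<omega> / prob A)"
    by simp
  finally show ?thesis by simp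
qed

context theta_positive_bpve
begin

lemma prob_Z:
  assumes t: "0 \<le> t"
  shows "prob {\<omega> \<in> space M. Z t \<omega> = k} = pmf (K 0 t 1) k"
proof -
  have [measurable]: "Z t \<in> M \<rightarrow>\<^sub>M count_space UNIV" "Z 0 \<in> M \<rightarrow>\<^sub>M count_space UNIV"
    using Z_measurable t by auto
  define tt where "tt i = (if i = (0::nat) then 0 else t)" for i
  define ii where "ii i = (if i = (0::nat) then 1 else k)" for i
  have le1: "(\<forall>j\<le>Suc 0. P j) \<longleftrightarrow> P 0 \<and> P 1" for P
    by (auto simp: le_Suc_eq)
  have "prob {\<omega> \<in> space M. Z 0 \<omega> = 1 \<and> Z t \<omega> = k} = prob {\<omega> \<in> space M. Z 0 \<omega> = 1} * pmf (K 0 t 1) k"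
    using markov[of tt 0 ii] t unfolding le1 by (simp add: tt_def ii_def)
  moreover have "prob {\<omega> \<in> space M. Z 0 \<omega> = 1} = 1"
    using Z_0 by (subst prob_Collect_eq_1) auto
  moreover have "prob {\<omega> \<in> space M. Z 0 \<omega> = 1 \<and> Z t \<omega> = k} = prob {\<omega> \<in> space M. Z t \<omega> = k}"
    using Z_0 by (intro measure_eq_AE) (auto elim!: eventually_mono)
  ultimately show ?thesis by simp
qed

lemma distr_Z:
  assumes t: "0 \<le> t"
  shows "distr M (count_space UNIV) (Z t) = measure_pmf (K 0 t 1)"
proof (rule measure_eqI_countable[where A = UNIV])
  fix k
  have Z: "Z t \<in> M \<rightarrow>\<^sub>M count_space UNIV" using Z_measurable t by auto
  have "Z t -` {k} \<inter> space M = {\<omega> \<in> space M. Z t \<omega> = k}" by auto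
  then show "emeasure (distr M (count_space UNIV) (Z t)) {k} = emeasure (measure_pmf (K 0 t 1)) {k}"
    using prob_Z[OF t, of k]
    by (simp add: emeasure_distr[OF Z] emeasure_eq_measure emeasure_pmf_single)
qed auto

lemma expectation_Z:
  assumes t: "0 \<le> t"
  shows "(LINT \<omega>|M. f (Z t \<omega>)) = measure_pmf.expectation (K 0 t 1) (f :: nat \<Rightarrow> real)"
  using integral_distr[of "Z t" M "count_space UNIV" f] Z_measurable[OF t]
  by (simp add: distr_Z[OF t])

lemma root_powr: "0 < x \<Longrightarrow> (x powr (- \<theta>)) powr (- 1 / \<theta>) = x"
  using theta_pos by (simp add: powr_powr)

lemma one_minus_pgf_pos:
  assumes "0 \<le> t" "0 \<le> x" "x < 1"
  shows "0 < 1 - pgf (K 0 t 1) x"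
proof -
  obtain c where c: "0 < c" "\<And>s. \<lbrakk>0 \<le> s; s \<le> t\<rbrakk> \<Longrightarrow> c \<le> pmf (K s t 1) 1"
    by (rule staying_single_bounded_below[OF assms(1)]) blast
  have "0 < pmf (K 0 t 1) 1" by (rule less_le_trans[OF c]) (use assms in auto)
  then have "0 < pmf (K 0 t 1) 1 * (1 - x)" using assms by simp
  also have "\<dots> \<le> 1 - pgf (K 0 t 1) x" using assms by (intro one_minus_pgf_ge) auto
  finally show ?thesis .
qed

text \<open>
  The difference quotients \<open>(1 - pgf q x) / (1 - x)\<close> are expectations of \<open>1 + x + \<dots> + x\<^bsup>k - 1\<^esup>\<close>, which
  increase to \<open>k\<close> as \<open>x \<rightarrow> 1\<close>. By the closed formula, the power \<open>- \<theta>\<close> of the quotient is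
  \<open>b (1 - x)\<^sup>\<theta> + \<mu>\<^sup>-\<^sup>\<theta>\<close> with \<open>b\<close> independent of \<open>x\<close>, so monotone convergence gives finiteness of the mean
  and its value together.
\<close>

lemma mean_K:
  assumes t: "0 \<le> t"
  shows "integrable (measure_pmf (K 0 t 1)) real" "measure_pmf.expectation (K 0 t 1) real = mean_fn t"
proof -
  define q where "q = K 0 t 1"
  define x where "x i = 1 - 1 / (real i + 2)" for i
  have x: "0 \<le> x i" "x i < 1" for i by (auto simp: x_def field_simps)
  have x_lim: "x \<longlonglongrightarrow> 1"
    unfolding x_def by real_asymp
  define g where "g i = 1 - x i" for i
  have g_pos: "0 < g i" for i using x(2)[of i] by (simp add: g_def)
  have g_lim: "g \<longlonglongrightarrow> 0" unfolding g_def using tendsto_diff[OF tendsto_const[of 1] x_lim] by simp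
  define f where "f i k = (\<Sum>j<k. x i ^ j)" for i and k :: nat
  have f_eq: "f i k = (1 - x i ^ k) / g i" for i k
    using x(2)[of i] by (simp add: f_def g_def sum_gp_strict)
  have f_int: "integrable (measure_pmf q) (f i)" for i
    unfolding f_eq using x(1)[of i] x(2)[of i]
    by (intro Bochner_Integration.integrable_divide Bochner_Integration.integrable_diff
        integrable_pmf_power) auto
  define r where "r i = (1 - pgf q (x i)) / g i" for i
  have r_pos: "0 < r i" for i
    unfolding r_def q_def using one_minus_pgf_pos[OF t] x g_pos by (intro divide_pos_pos) auto
  have f_exp: "measure_pmf.expectation q (f i) = r i" for i
    unfolding f_eq r_def pgf_def using integrable_pmf_power[of "x i" q] x[of i] by simp
  define b where "b = V t + 1 / (1 + \<theta>) - mean_fn t powr (- \<theta>) / (1 + \<theta>)"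
  have r_powr: "r i powr (- \<theta>) = b * g i powr \<theta> + mean_fn t powr (- \<theta>)" for i
  proof -
    have "r i powr (- \<theta>) = (1 - pgf q (x i)) powr (- \<theta>) * g i powr \<theta>"
      unfolding r_def using g_pos[of i] one_minus_pgf_pos[OF t x, of i]
      by (simp add: powr_divide q_def powr_minus field_simps)
    also have "(1 - pgf q (x i)) powr (- \<theta>) = b + mean_fn t powr (- \<theta>) * g i powr (- \<theta>)"
      unfolding q_def survival_pgf_formula[OF t x] by (simp add: b_def g_def right_diff_distrib)
    finally show ?thesis using g_pos[of i] by (simp add: powr_minus field_simps)
  qed
  have "(\<lambda>i. g i powr \<theta>) \<longlonglongrightarrow> 0 powr \<theta>"
    using g_lim g_pos theta_pos
    by (intro tendsto_powr' tendsto_const) (auto intro!: always_eventually less_imp_le)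
  then have "(\<lambda>i. b * g i powr \<theta> + mean_fn t powr (- \<theta>)) \<longlonglongrightarrow> b * 0 + mean_fn t powr (- \<theta>)"
    using theta_pos by (intro tendsto_intros) auto
  then have "(\<lambda>i. r i powr (- \<theta>)) \<longlonglongrightarrow> mean_fn t powr (- \<theta>)"
    by (simp add: r_powr)
  then have "(\<lambda>i. (r i powr (- \<theta>)) powr (- 1 / \<theta>)) \<longlonglongrightarrow> (mean_fn t powr (- \<theta>)) powr (- 1 / \<theta>)"
    by (rule tendsto_powr[OF _ tendsto_const]) (use mean_fn_pos[of t] in auto)
  then have r_lim: "r \<longlonglongrightarrow> mean_fn t"
    by (simp only: root_powr[OF r_pos] root_powr[OF mean_fn_pos])
  have mono: "mono (\<lambda>i. f i k)" for k
  proof (rule monoI)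
    fix i j :: nat assume "i \<le> j"
    then have "x i \<le> x j" by (simp add: x_def frac_le)
    then show "f i k \<le> f j k" unfolding f_def using x by (intro sum_mono power_mono) auto
  qed
  have f_lim: "(\<lambda>i. f i k) \<longlonglongrightarrow> real k" for k
  proof -
    have "(\<lambda>i. f i k) \<longlonglongrightarrow> (\<Sum>j<k. 1 ^ j)"
      unfolding f_def by (intro tendsto_intros x_lim)
    then show ?thesis by simp
  qed
  have nonneg: "0 \<le> f i k" for i k unfolding f_def using x by (intro sum_nonneg) auto
  note mc = integral_monotone_convergence_nonneg[where M = "measure_pmf q" and f = f and u = real and x = "mean_fn t",
      OF f_int]
  show "integrable (measure_pmf (K 0 t 1)) real"
    unfolding q_def[symmetric] using mono nonneg f_lim r_lim by (intro mc) (auto simp: f_exp)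
  show "measure_pmf.expectation (K 0 t 1) real = mean_fn t"
    unfolding q_def[symmetric] using mono nonneg f_lim r_lim by (intro mc) (auto simp: f_exp)
qed

lemma bp_mean_eq: "0 \<le> t \<Longrightarrow> bp_mean M Z t = mean_fn t"
  unfolding bp_mean_def expectation_Z[of t real] by (rule mean_K)

lemma bp_V_eq:
  assumes t: "0 \<le> t"
  shows "bp_V M Z \<theta> lam t = V t"
proof -
  have "(LBINT u:{0..t}. bp_mean M Z u powr (- \<theta>) * lam u) = (LBINT u:{0..t}. mean_fn u powr (- \<theta>) * lam u)"
    by (intro set_lebesgue_integral_cong) (auto simp: bp_mean_eq)
  then show ?thesis by (simp add: bp_V_def V_def cum_rate_def)
qed

lemma V_mono:
  assumes "0 \<le> s" "s \<le> t"
  shows "V s \<le> V t"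
proof -
  have c: "continuous_on {0..t} (\<lambda>u. mean_fn u powr (- \<theta>))"
    unfolding mean_fn_powr using assms
    by (intro continuous_intros B_continuous cum_rate_continuous lam_integrable) auto
  have "cum_rate (\<lambda>u. mean_fn u powr (- \<theta>) * lam u) t - cum_rate (\<lambda>u. mean_fn u powr (- \<theta>) * lam u) s
      = (LBINT u:{s..t}. mean_fn u powr (- \<theta>) * lam u)"
    using assms by (intro cum_rate_diff continuous_rate_integrable c) auto
  also have "0 \<le> \<dots>"
    unfolding set_lebesgue_integral_def
    using assms lam_nonneg by (intro integral_nonneg_AE always_eventually) (auto split: split_indicator)
  finally show ?thesis
    using theta_pos by (simp add: V_def divide_right_mono mult_left_mono)
qed

lemma V_nonneg: "0 \<le> t \<Longrightarrow> 0 \<le> V t"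
  using V_mono[of 0 t] by (simp add: V_def cum_rate_0)

definition surv :: "real \<Rightarrow> real" where "surv t = 1 - pgf (K 0 t 1) 0"

lemma surv_pos: "0 \<le> t \<Longrightarrow> 0 < surv t"
  unfolding surv_def by (rule one_minus_pgf_pos) auto

lemma surv_formula:
  "0 \<le> t \<Longrightarrow> surv t powr (- \<theta>) = V t + 1 / (1 + \<theta>) + \<theta> / (1 + \<theta>) * mean_fn t powr (- \<theta>)"
  using survival_pgf_formula[of t 0] theta_pos by (simp add: surv_def field_simps)

text \<open>
  Extinction is absorbing: the composition law inserts a number \<open>\<ge> 0\<close> into an increasing
  generating function. The limit that defines the extinction probability therefore exists.
\<close>

lemma surv_antimono:
  assumes "0 \<le> s" "s \<le> t"
  shows "surv t \<le> surv s"
proof -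
  have "pgf (K 0 s 1) 0 \<le> pgf (K 0 s 1) (pgf (K s t 1) 0)"
    unfolding pgf_def[of "K 0 s 1"]
    using pgf_nonneg[of 0 "K s t 1"] pgf_le_1[of 0 "K s t 1"]
    by (intro integral_mono integrable_pmf_power power_mono) auto
  then show ?thesis
    using pgf_semigroup[of 0 s t 0] assms by (simp add: surv_def)
qed

lemma prob_extinct: "0 \<le> t \<Longrightarrow> prob {\<omega> \<in> space M. Z t \<omega> = 0} = 1 - surv t"
  by (simp add: prob_Z surv_def pgf_0)

lemma survival_event_measurable: "0 \<le> t \<Longrightarrow> survival_event M Z t \<in> events"
  using Z_measurable[of t] unfolding survival_event_def by measurable

lemma prob_survival:
  assumes t: "0 \<le> t"
  shows "prob (survival_event M Z t) = surv t"
proof -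
  have "{\<omega> \<in> space M. Z t \<omega> = 0} = space M - survival_event M Z t"
    by (auto simp: survival_event_def)
  then have "prob {\<omega> \<in> space M. Z t \<omega> = 0} = 1 - prob (survival_event M Z t)"
    using prob_compl[OF survival_event_measurable[OF t]] by simp
  then show ?thesis using prob_extinct[OF t] by simp
qed

lemma cond_expectation_Z:
  assumes t: "0 \<le> t" and f: "integrable (measure_pmf (K 0 t 1)) f"
  shows "(LINT \<omega>|uniform_measure M (survival_event M Z t). f (Z t \<omega>))
    = (measure_pmf.expectation (K 0 t 1) f - f 0 * (1 - surv t)) / surv t"
proof -
  have [measurable]: "Z t \<in> M \<rightarrow>\<^sub>M count_space UNIV" using Z_measurable t by auto
  have "(LINT \<omega>|uniform_measure M (survival_event M Z t). f (Z t \<omega>))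
      = (LINT \<omega>|M. indicator (survival_event M Z t) \<omega> * f (Z t \<omega>)) / surv t"
    using survival_event_measurable[OF t] prob_survival[OF t] surv_pos[OF t]
    by (subst integral_uniform_measure) auto
  also have "(LINT \<omega>|M. indicator (survival_event M Z t) \<omega> * f (Z t \<omega>))
      = (LINT \<omega>|M. (f (Z t \<omega>) - f 0 * indicator {0} (Z t \<omega>)))"
    by (intro Bochner_Integration.integral_cong)
      (auto simp: survival_event_def split: split_indicator)
  also have "\<dots> = measure_pmf.expectation (K 0 t 1) (\<lambda>k. f k - f 0 * indicator {0} k)"
    by (rule expectation_Z[OF t, of "\<lambda>k. f k - f 0 * indicator {0} k"])
  also have "\<dots> = measure_pmf.expectation (K 0 t 1) f - f 0 * (1 - surv t)"
  proof -
    have "integrable (measure_pmf (K 0 t 1)) (\<lambda>k. f 0 * indicator {0} k)"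
      by (intro measure_pmf.integrable_const_bound[where B = "\<bar>f 0\<bar>"])
        (auto split: split_indicator)
    then show ?thesis
      using f by (simp add: measure_pmf_single surv_def pgf_0)
  qed
  finally show ?thesis .
qed

lemma bp_cond_mean_eq: "0 \<le> t \<Longrightarrow> bp_cond_mean M Z t = mean_fn t / surv t"
  unfolding bp_cond_mean_def using cond_expectation_Z[OF _ mean_K(1), of t]
  by (simp del: One_nat_def add: mean_K)

lemma cond_laplace_eq:
  assumes t: "0 \<le> t" and w: "0 \<le> w"
  shows "(LINT \<omega>|uniform_measure M (survival_event M Z t). exp (- (w * real (Z t \<omega>))))
    = 1 - (1 - pgf (K 0 t 1) (exp (- w))) / surv t"
proof -
  have eq: "exp (- (w * real k)) = exp (- w) ^ k" for k
    by (simp add: exp_of_nat_mult[symmetric] mult.commute)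
  have "(LINT \<omega>|uniform_measure M (survival_event M Z t). exp (- w) ^ Z t \<omega>)
    = (pgf (K 0 t 1) (exp (- w)) - exp (- w) ^ 0 * (1 - surv t)) / surv t"
    unfolding pgf_def using w by (intro cond_expectation_Z[OF t] integrable_pmf_power) auto
  then show ?thesis
    using surv_pos[OF t] by (simp add: eq field_simps)
qed

end

section \<open>Asymptotics\<close>

lemma powr_to_infinity_iff:
  fixes f :: "'b \<Rightarrow> real"
  assumes "0 < \<theta>" and pos: "eventually (\<lambda>t. 0 < f t) F"
  shows "filterlim (\<lambda>t. f t powr \<theta>) at_top F \<longleftrightarrow> filterlim f at_top F"
proof -
  have *: "filterlim (\<lambda>t. g t powr c) at_top F" if "0 < c" "filterlim g at_top F" for c and g :: "'b \<Rightarrow> real"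
  proof (rule filterlim_compose[OF _ that(2)])
    show "filterlim (\<lambda>x::real. x powr c) at_top at_top" using that(1) by real_asymp
  qed
  show ?thesis
  proof
    assume "filterlim (\<lambda>t. f t powr \<theta>) at_top F"
    from *[OF _ this, of "1 / \<theta>"] assms(1)
    have "filterlim (\<lambda>t. (f t powr \<theta>) powr (1 / \<theta>)) at_top F" by simp
    then show "filterlim f at_top F"
      by (rule filterlim_cong[THEN iffD1, rotated -1])
        (use pos assms(1) in \<open>auto elim!: eventually_mono simp: powr_powr\<close>)
  qed (rule *[OF assms(1)])
qed

lemma eventually_at_top_nonnegI: "(\<And>t::real. 0 \<le> t \<Longrightarrow> P t) \<Longrightarrow> eventually P at_top"
  unfolding eventually_at_top_linorder by blast

lemma filterlim_cong_nonneg: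
  fixes f :: "real \<Rightarrow> 'b"
  shows "(\<And>t. 0 \<le> t \<Longrightarrow> f t = g t) \<Longrightarrow> filterlim f F at_top \<longleftrightarrow> filterlim g F at_top"
  by (intro filterlim_cong refl eventually_at_top_nonnegI)

lemma mono_not_at_top_imp_bounded:
  fixes f :: "real \<Rightarrow> real"
  assumes mono: "\<And>s t. \<lbrakk>0 \<le> s; s \<le> t\<rbrakk> \<Longrightarrow> f s \<le> f t" and "\<not> filterlim f at_top at_top"
  obtains b where "\<And>t. 0 \<le> t \<Longrightarrow> f t \<le> b"
proof -
  obtain b where b: "\<not> eventually (\<lambda>t. b \<le> f t) at_top"
    using assms(2) unfolding filterlim_at_top by blast
  have "f t \<le> b" if t: "0 \<le> t" for t
  proof (rule ccontr)
    assume "\<not> f t \<le> b"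
    then have "b \<le> f u" if "t \<le> u" for u
      using mono[OF t that] by simp
    then have "eventually (\<lambda>t. b \<le> f t) at_top"
      unfolding eventually_at_top_linorder by blast
    with b show False by simp
  qed
  then show thesis by (rule that)
qed

lemma monotone_at_top_limit:
  fixes f :: "real \<Rightarrow> 'b :: {complete_linorder, linorder_topology}"
  assumes mono: "\<And>s t. \<lbrakk>0 \<le> s; s \<le> t\<rbrakk> \<Longrightarrow> f s \<le> f t"
  shows "(f \<longlongrightarrow> (SUP t\<in>{0..}. f t)) at_top"
proof (rule order_tendstoI)
  fix l assume "l < (SUP t\<in>{0..}. f t)"
  then obtain t where t: "0 \<le> t" "l < f t" by (auto simp: less_SUP_iff)
  then have "l < f u" if "t \<le> u" for u using mono[OF t(1) that] by simp
  then show "eventually (\<lambda>t. l < f t) at_top"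
    unfolding eventually_at_top_linorder by blast
next
  fix l assume l: "(SUP t\<in>{0..}. f t) < l"
  show "eventually (\<lambda>t. f t < l) at_top"
    using eventually_ge_at_top[of 0]
  proof eventually_elim
    case (elim t)
    then have "f t \<le> (SUP t\<in>{0..}. f t)" by (intro SUP_upper) simp
    then show ?case using l by simp
  qed
qed

text \<open>
  \<open>Lim\<close> says nothing about a function that does not converge; a monotone function with values in a
  complete linear order does.
\<close>

lemma Lim_eq_iff_monotone:
  fixes f :: "real \<Rightarrow> 'b :: {complete_linorder, linorder_topology, t2_space}"
  assumes "\<And>s t. \<lbrakk>0 \<le> s; s \<le> t\<rbrakk> \<Longrightarrow> f s \<le> f t"
  shows "Lim at_top f = l \<longleftrightarrow> (f \<longlongrightarrow> l) at_top"
proof -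
  have lim: "(f \<longlongrightarrow> (SUP t\<in>{0..}. f t)) at_top"
    by (rule monotone_at_top_limit[OF assms])
  then have eq: "Lim at_top f = (SUP t\<in>{0..}. f t)"
    by (intro tendsto_Lim trivial_limit_at_top_linorder)
  show ?thesis
    unfolding eq
  proof
    show "(f \<longlongrightarrow> l) at_top" if "(SUP t\<in>{0..}. f t) = l"
      using lim unfolding that .
    show "(SUP t\<in>{0..}. f t) = l" if "(f \<longlongrightarrow> l) at_top"
      by (rule tendsto_unique[OF trivial_limit_at_top_linorder lim that])
  qed
qed

context theta_positive_bpve
begin

lemma extinction_certain_iff: "bp_extinction_prob M Z = 1 \<longleftrightarrow> (surv \<longlongrightarrow> 0) at_top"
proof -
  define e where "e t = measure M {\<omega> \<in> space M. Z t \<omega> = 0}" for t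
  have e: "e t = 1 - surv t" if "0 \<le> t" for t
    using prob_extinct[OF that] by (simp add: e_def)
  have ev: "eventually (\<lambda>t. e t = 1 - surv t) at_top"
    using eventually_ge_at_top[of 0] by eventually_elim (rule e)
  (* In the extended reals the supremum exists; it is finite because e t is a probability. *)
  have conv: "((\<lambda>t. ereal (e t)) \<longlongrightarrow> (SUP t\<in>{0..}. ereal (e t))) at_top"
    by (rule monotone_at_top_limit) (use e surv_antimono in auto)
  define s where "s = (SUP t\<in>{0..}. ereal (e t))"
  have "\<bar>s\<bar> \<noteq> \<infinity>"
  proof -
    have "s \<le> ereal 1" unfolding s_def by (intro SUP_least) (auto simp: e_def)
    moreover have "ereal (e 0) \<le> s" unfolding s_def by (intro SUP_upper) auto
    ultimately show ?thesis by (cases s) auto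
  qed
  then obtain l where l: "s = ereal l" by (cases s) auto
  have e_lim: "(e \<longlongrightarrow> l) at_top" using conv unfolding s_def[symmetric] l by simp
  then have "bp_extinction_prob M Z = l"
    unfolding bp_extinction_prob_def e_def by (intro tendsto_Lim) auto
  moreover have "(surv \<longlongrightarrow> 1 - l) at_top"
  proof (rule Lim_transform_eventually[OF tendsto_diff[OF tendsto_const e_lim]])
    show "eventually (\<lambda>t. 1 - e t = surv t) at_top" using ev by eventually_elim simp
  qed
  ultimately show ?thesis
    using tendsto_unique[of "at_top :: real filter" surv "1 - l" 0] by auto
qed

lemma bp_V_lim_infinite_iff: "bp_V_lim M Z \<theta> lam = \<infinity> \<longleftrightarrow> filterlim V at_top at_top"
proof -
  have "bp_V_lim M Z \<theta> lam = \<infinity> \<longleftrightarrow> ((\<lambda>t. ereal (bp_V M Z \<theta> lam t)) \<longlongrightarrow> \<infinity>) at_top"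
    unfolding bp_V_lim_def by (rule Lim_eq_iff_monotone) (auto simp: bp_V_eq intro!: V_mono)
  also have "\<dots> \<longleftrightarrow> ((\<lambda>t. ereal (V t)) \<longlongrightarrow> \<infinity>) at_top"
    by (rule filterlim_cong_nonneg) (simp add: bp_V_eq)
  also have "\<dots> \<longleftrightarrow> filterlim V at_top at_top"
    by (simp add: tendsto_PInfty_eq_at_top)
  finally show ?thesis .
qed

text \<open>
  The closed form of \<open>m\<^sup>\<theta>\<close>, for the conditional mean \<open>m = \<mu> / P (Z t > 0)\<close>.
\<close>

lemma cond_mean_powr:
  assumes t: "0 \<le> t"
  shows "(mean_fn t / surv t) powr \<theta> = mean_fn t powr \<theta> * (V t + 1 / (1 + \<theta>)) + \<theta> / (1 + \<theta>)"
proof -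
  have "(mean_fn t / surv t) powr \<theta> = mean_fn t powr \<theta> * surv t powr (- \<theta>)"
    unfolding powr_divide by (simp add: powr_minus divide_inverse)
  also have "\<dots> = mean_fn t powr \<theta> * (V t + 1 / (1 + \<theta>)) + \<theta> / (1 + \<theta>) * (mean_fn t powr \<theta> * mean_fn t powr (- \<theta>))"
    unfolding surv_formula[OF t] by (simp add: algebra_simps)
  also have "mean_fn t powr \<theta> * mean_fn t powr (- \<theta>) = 1"
    using mean_fn_pos[of t] by (simp add: powr_minus)
  finally show ?thesis by simp
qed

lemma surv_tendsto_0_iff:
  "(surv \<longlongrightarrow> 0) at_top \<longleftrightarrow> filterlim (\<lambda>t. surv t powr (- \<theta>)) at_top at_top"
proof -
  have pos: "eventually (\<lambda>t. 0 < surv t) at_top"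
    using eventually_ge_at_top[of 0] by eventually_elim (rule surv_pos)
  have "(surv \<longlongrightarrow> 0) at_top \<longleftrightarrow> filterlim (\<lambda>t. inverse (surv t)) at_top at_top"
    using filterlim_inverse_at_top[OF _ pos] tendsto_inverse_0_at_top[of "\<lambda>t. inverse (surv t)" at_top]
    by auto
  also have "\<dots> \<longleftrightarrow> filterlim (\<lambda>t. inverse (surv t) powr \<theta>) at_top at_top"
    by (rule powr_to_infinity_iff[symmetric, OF theta_pos]) (use pos in \<open>auto elim!: eventually_mono\<close>)
  also have "\<dots> \<longleftrightarrow> filterlim (\<lambda>t. surv t powr (- \<theta>)) at_top at_top"
    by (rule filterlim_cong) (use pos in \<open>auto elim!: eventually_mono simp: powr_minus inverse_powr\<close>)
  finally show ?thesis .
qed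

lemma cond_mean_infinite_iff:
  "filterlim (bp_cond_mean M Z) at_top at_top \<longleftrightarrow>
    filterlim (\<lambda>t. mean_fn t powr \<theta> * (V t + 1 / (1 + \<theta>)) + \<theta> / (1 + \<theta>)) at_top at_top"
proof -
  have "filterlim (bp_cond_mean M Z) at_top at_top \<longleftrightarrow> filterlim (\<lambda>t. mean_fn t / surv t) at_top at_top"
    by (rule filterlim_cong_nonneg) (simp add: bp_cond_mean_eq)
  also have "\<dots> \<longleftrightarrow> filterlim (\<lambda>t. (mean_fn t / surv t) powr \<theta>) at_top at_top"
    by (rule powr_to_infinity_iff[symmetric, OF theta_pos])
      (rule eventually_at_top_nonnegI, simp add: surv_pos mean_fn_pos)
  also have "\<dots> \<longleftrightarrow> filterlim (\<lambda>t. mean_fn t powr \<theta> * (V t + 1 / (1 + \<theta>)) + \<theta> / (1 + \<theta>)) at_top at_top"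
    by (rule filterlim_cong_nonneg) (simp add: cond_mean_powr)
  finally show ?thesis .
qed

text \<open>
  For the direction from left to right, suppose that \<open>V\<close> is bounded. Then \<open>m \<rightarrow> \<infinity>\<close> makes
  \<open>\<mu>\<^sup>\<theta> \<ge> 1\<close> at late times, so \<open>\<mu>\<^sup>-\<^sup>\<theta> \<le> 1\<close> and \<open>P (Z t > 0)\<^sup>-\<^sup>\<theta>\<close> stays bounded, which contradicts
  extinction. Once \<open>V \<rightarrow> \<infinity>\<close> is known, \<open>V + 1 / (1 + \<theta>) \<le> 2 V\<close> eventually.
\<close>

lemma critical_iff:
  "bp_critical M Z \<longleftrightarrow>
    filterlim V at_top at_top \<and> filterlim (\<lambda>t. mean_fn t powr \<theta> * V t) at_top at_top"
proof
  assume "bp_critical M Z"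
  then have S: "filterlim (\<lambda>t. surv t powr (- \<theta>)) at_top at_top"
    and m: "filterlim (\<lambda>t. mean_fn t powr \<theta> * (V t + 1 / (1 + \<theta>)) + \<theta> / (1 + \<theta>)) at_top at_top"
    by (auto simp: bp_critical_def extinction_certain_iff surv_tendsto_0_iff cond_mean_infinite_iff)
  have m1: "filterlim (\<lambda>t. mean_fn t powr \<theta> * (V t + 1 / (1 + \<theta>))) at_top at_top"
    using filterlim_tendsto_add_at_top[OF tendsto_const[of "- \<theta> / (1 + \<theta>)"] m] by simp
  show "filterlim V at_top at_top \<and> filterlim (\<lambda>t. mean_fn t powr \<theta> * V t) at_top at_top"
  proof
    show V: "filterlim V at_top at_top"
    proof (rule ccontr)
      assume "\<not> filterlim V at_top at_top"
      then obtain b where b: "\<And>t. 0 \<le> t \<Longrightarrow> V t \<le> b"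
        using mono_not_at_top_imp_bounded[of V] V_mono by metis
      define b' where "b' = b + 1 / (1 + \<theta>)"
      have b': "0 < b'" using b[of 0] V_nonneg[of 0] theta_pos by (simp add: b'_def add_nonneg_pos)
      have "eventually (\<lambda>t. b' \<le> mean_fn t powr \<theta> * (V t + 1 / (1 + \<theta>))) at_top"
        using m1 by (simp add: filterlim_at_top)
      moreover have "eventually (\<lambda>t. b' + 1 < surv t powr (- \<theta>)) at_top"
        using S by (simp add: filterlim_at_top_dense)
      ultimately have "eventually (\<lambda>t. b' \<le> mean_fn t powr \<theta> * (V t + 1 / (1 + \<theta>)) \<and>
          b' + 1 < surv t powr (- \<theta>) \<and> 0 \<le> t) at_top"
        using eventually_ge_at_top[of 0] by eventually_elim simp
      from eventually_happens'[OF trivial_limit_at_top_linorder this]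
      obtain t where t: "b' \<le> mean_fn t powr \<theta> * (V t + 1 / (1 + \<theta>))"
          "b' + 1 < surv t powr (- \<theta>)" "0 \<le> t"
        by blast
      have "b' * 1 \<le> b' * mean_fn t powr \<theta>"
        using t(1) mult_left_mono[of "V t + 1 / (1 + \<theta>)" b' "mean_fn t powr \<theta>"] b[OF t(3)]
        by (simp add: b'_def mult.commute)
      then have "1 \<le> mean_fn t powr \<theta>" using b' by simp
      then have "mean_fn t powr (- \<theta>) \<le> 1"
        by (simp add: powr_minus inverse_le_1_iff)
      then have "\<theta> / (1 + \<theta>) * mean_fn t powr (- \<theta>) \<le> 1 * 1"
        using theta_pos by (intro mult_mono) auto
      then show False using t(2) b[OF t(3)] unfolding surv_formula[OF t(3)] b'_def by simp
    qed
    show "filterlim (\<lambda>t. mean_fn t powr \<theta> * V t) at_top at_top"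
    proof (rule filterlim_at_top_mono)
      show "filterlim (\<lambda>t. 1 / 2 * (mean_fn t powr \<theta> * (V t + 1 / (1 + \<theta>)))) at_top at_top"
        by (rule filterlim_tendsto_pos_mult_at_top[OF tendsto_const _ m1]) simp
      have "eventually (\<lambda>t. 1 / (1 + \<theta>) \<le> V t) at_top"
        using V by (simp add: filterlim_at_top)
      then show "eventually (\<lambda>t. 1 / 2 * (mean_fn t powr \<theta> * (V t + 1 / (1 + \<theta>))) \<le> mean_fn t powr \<theta> * V t) at_top"
      proof eventually_elim
        case (elim t)
        then have "mean_fn t powr \<theta> * (V t + 1 / (1 + \<theta>)) \<le> mean_fn t powr \<theta> * (2 * V t)"
          by (intro mult_left_mono) auto
        then show ?case by simp
      qed
    qed
  qed
next
  assume "filterlim V at_top at_top \<and> filterlim (\<lambda>t. mean_fn t powr \<theta> * V t) at_top at_top"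
  then have V: "filterlim V at_top at_top" and mV: "filterlim (\<lambda>t. mean_fn t powr \<theta> * V t) at_top at_top"
    by auto
  have "filterlim (\<lambda>t. surv t powr (- \<theta>)) at_top at_top"
    by (rule filterlim_at_top_mono[OF V])
      (rule eventually_at_top_nonnegI, use theta_pos in \<open>simp add: surv_formula\<close>)
  moreover have "filterlim (\<lambda>t. mean_fn t powr \<theta> * (V t + 1 / (1 + \<theta>)) + \<theta> / (1 + \<theta>)) at_top at_top"
    by (rule filterlim_at_top_mono[OF mV])
      (use theta_pos in \<open>auto intro!: always_eventually simp: distrib_left\<close>)
  ultimately show "bp_critical M Z"
    by (simp add: bp_critical_def extinction_certain_iff surv_tendsto_0_iff cond_mean_infinite_iff)
qed

context
  assumes V_at_top: "filterlim V at_top at_top"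
    and mean_V_at_top: "filterlim (\<lambda>t. mean_fn t powr \<theta> * V t) at_top at_top"
begin

lemma V_eventually_pos: "eventually (\<lambda>t. 0 < V t \<and> 0 \<le> t) at_top"
proof -
  have "eventually (\<lambda>t. 0 < V t) at_top" using V_at_top by (simp add: filterlim_at_top_dense)
  then show ?thesis using eventually_ge_at_top[of 0] by eventually_elim simp
qed

lemma inverse_mean_V: "((\<lambda>t. mean_fn t powr (- \<theta>) / V t) \<longlongrightarrow> 0) at_top"
proof -
  have "((\<lambda>t. inverse (mean_fn t powr \<theta> * V t)) \<longlongrightarrow> 0) at_top"
    by (rule tendsto_inverse_0_at_top[OF mean_V_at_top])
  then show ?thesis by (simp add: powr_minus divide_inverse)
qed

lemma inverse_V: "((\<lambda>t. c / V t) \<longlongrightarrow> 0) at_top"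
  using tendsto_mult[OF tendsto_const[of c] tendsto_inverse_0_at_top[OF V_at_top]]
  by (simp add: divide_inverse)

lemma surv_powr_over_V: "((\<lambda>t. surv t powr (- \<theta>) / V t) \<longlongrightarrow> 1) at_top"
proof -
  have "((\<lambda>t. 1 + 1 / (1 + \<theta>) / V t + \<theta> / (1 + \<theta>) * (mean_fn t powr (- \<theta>) / V t))
      \<longlongrightarrow> 1 + 0 + \<theta> / (1 + \<theta>) * 0) at_top"
    by (intro tendsto_intros inverse_V inverse_mean_V)
  then have "((\<lambda>t. 1 + 1 / (1 + \<theta>) / V t + \<theta> / (1 + \<theta>) * (mean_fn t powr (- \<theta>) / V t)) \<longlongrightarrow> 1) at_top"
    by simp
  then show ?thesis
  proof (rule Lim_transform_eventually)
    show "eventually (\<lambda>t. 1 + 1 / (1 + \<theta>) / V t + \<theta> / (1 + \<theta>) * (mean_fn t powr (- \<theta>) / V t)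
        = surv t powr (- \<theta>) / V t) at_top"
      using V_eventually_pos
    proof eventually_elim
      case (elim t)
      then show ?case by (simp add: surv_formula add_divide_distrib)
    qed
  qed
qed

lemma surv_asymptotics: "((\<lambda>t. surv t / V t powr (- 1 / \<theta>)) \<longlongrightarrow> 1) at_top"
proof -
  have "((\<lambda>t. (surv t powr (- \<theta>) / V t) powr (- 1 / \<theta>)) \<longlongrightarrow> 1 powr (- 1 / \<theta>)) at_top"
    by (rule tendsto_powr[OF surv_powr_over_V tendsto_const]) simp
  then have "((\<lambda>t. (surv t powr (- \<theta>) / V t) powr (- 1 / \<theta>)) \<longlongrightarrow> 1) at_top" by simp
  then show ?thesis
  proof (rule Lim_transform_eventually)
    show "eventually (\<lambda>t. (surv t powr (- \<theta>) / V t) powr (- 1 / \<theta>) = surv t / V t powr (- 1 / \<theta>)) at_top"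
      using V_eventually_pos
    proof eventually_elim
      case (elim t)
      then show ?case by (simp only: powr_divide root_powr surv_pos)
    qed
  qed
qed

lemma cond_mean_asymptotics: "((\<lambda>t. (mean_fn t / surv t) / (mean_fn t * V t powr (1 / \<theta>))) \<longlongrightarrow> 1) at_top"
proof -
  have "((\<lambda>t. inverse (surv t / V t powr (- 1 / \<theta>))) \<longlongrightarrow> inverse 1) at_top"
    by (rule tendsto_inverse[OF surv_asymptotics]) simp
  moreover have "inverse (surv t / V t powr (- 1 / \<theta>)) = (mean_fn t / surv t) / (mean_fn t * V t powr (1 / \<theta>))" for t
    using mean_fn_pos[of t] by (simp add: powr_minus_divide field_simps)
  ultimately show ?thesis by simp
qed

lemma cond_mean_at_top: "filterlim (\<lambda>t. mean_fn t / surv t) at_top at_top"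
proof -
  have "filterlim (bp_cond_mean M Z) at_top at_top"
    using critical_iff V_at_top mean_V_at_top by (simp add: bp_critical_def)
  then show ?thesis
    by (rule filterlim_cong_nonneg[THEN iffD1, rotated]) (simp add: bp_cond_mean_eq)
qed

text \<open>
  Let \<open>R\<close> be the ratio in question. Dividing the closed formula at \<open>x\<close> by the one at \<open>0\<close> gives
  \<open>R\<^sup>-\<^sup>\<theta> = 1 - m\<^sup>-\<^sup>\<theta> + (m (1 - x))\<^sup>-\<^sup>\<theta>\<close>, because \<open>\<mu>\<^sup>-\<^sup>\<theta> / P (Z t > 0)\<^sup>-\<^sup>\<theta> = m\<^sup>-\<^sup>\<theta>\<close>. As \<open>m \<rightarrow> \<infinity>\<close>, the second
  term vanishes and \<open>m (1 - exp (- w / m)) \<rightarrow> w\<close>.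
\<close>

lemma laplace_limit:
  assumes w: "0 < w"
  defines "x \<equiv> \<lambda>t. exp (- (w / (mean_fn t / surv t)))"
  shows "((\<lambda>t. (1 - pgf (K 0 t 1) (x t)) / surv t) \<longlongrightarrow> (1 + w powr (- \<theta>)) powr (- 1 / \<theta>)) at_top"
proof -
  define m where "m t = mean_fn t / surv t" for t
  have m_pos: "0 < m t" if "0 \<le> t" for t
    unfolding m_def using mean_fn_pos surv_pos[OF that] by simp
  define R where "R t = (1 - pgf (K 0 t 1) (x t)) / surv t" for t
  have x: "0 \<le> x t" "x t < 1" if "0 \<le> t" for t
    using divide_pos_pos[OF w m_pos[OF that]] by (auto simp: x_def m_def)
  have R_pos: "0 < R t" if "0 \<le> t" for t
    unfolding R_def using one_minus_pgf_pos[OF that x[OF that]] surv_pos[OF that] by simp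
  (* The quotient is expanded by V t because the limits of both of its parts relative to V t are
     known. *)
  have R_powr: "R t powr (- \<theta>) = 1 - mean_fn t powr (- \<theta>) / V t / (surv t powr (- \<theta>) / V t)
      + (m t * (1 - x t)) powr (- \<theta>)"
    if t: "0 < V t" "0 \<le> t" for t
  proof -
    define E where "E = mean_fn t powr (- \<theta>)"
    define S where "S = surv t powr (- \<theta>)"
    have S: "0 < S" using surv_pos[OF t(2)] by (simp add: S_def)
    have frac: "\<theta> / (1 + \<theta>) = 1 - 1 / (1 + \<theta>)" using theta_pos by (simp add: field_simps)
    have "(1 - pgf (K 0 t 1) (x t)) powr (- \<theta>) = S - E + E * (1 - x t) powr (- \<theta>)"
      unfolding survival_pgf_formula[OF t(2) x[OF t(2)]] S_def surv_formula[OF t(2)] E_def frac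
      by (simp add: algebra_simps)
    then have "R t powr (- \<theta>) = (S - E + E * (1 - x t) powr (- \<theta>)) / S"
      unfolding R_def S_def by (simp add: powr_divide)
    also have "\<dots> = 1 - E / S + E / S * (1 - x t) powr (- \<theta>)"
      using S by (simp add: field_simps)
    also have "E / S = m t powr (- \<theta>)"
      by (simp add: E_def S_def m_def powr_divide)
    also have "m t powr (- \<theta>) * (1 - x t) powr (- \<theta>) = (m t * (1 - x t)) powr (- \<theta>)"
      by (simp add: powr_mult)
    also have "m t powr (- \<theta>) = E / V t / (S / V t)"
      using t(1) by (simp add: E_def S_def m_def powr_divide)
    finally show ?thesis by (simp add: E_def S_def)
  qed
  have "((\<lambda>t. m t * (1 - x t)) \<longlongrightarrow> w) at_top"
  proof -
    have "((\<lambda>y::real. y * (1 - exp (- (w / y)))) \<longlongrightarrow> w) at_top"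
      by real_asymp
    from filterlim_compose[OF this cond_mean_at_top] show ?thesis by (simp add: m_def x_def)
  qed
  then have "((\<lambda>t. (m t * (1 - x t)) powr (- \<theta>)) \<longlongrightarrow> w powr (- \<theta>)) at_top"
    using w by (intro tendsto_powr tendsto_const) auto
  then have "((\<lambda>t. 1 - mean_fn t powr (- \<theta>) / V t / (surv t powr (- \<theta>) / V t)
      + (m t * (1 - x t)) powr (- \<theta>)) \<longlongrightarrow> 1 - 0 / 1 + w powr (- \<theta>)) at_top"
    by (intro tendsto_add tendsto_diff tendsto_divide tendsto_const inverse_mean_V surv_powr_over_V) auto
  then have "((\<lambda>t. R t powr (- \<theta>)) \<longlongrightarrow> 1 - 0 / 1 + w powr (- \<theta>)) at_top"
    by (rule Lim_transform_eventually)
      (use V_eventually_pos in eventually_elim, simp add: R_powr)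
  then have "((\<lambda>t. (R t powr (- \<theta>)) powr (- 1 / \<theta>)) \<longlongrightarrow> (1 - 0 / 1 + w powr (- \<theta>)) powr (- 1 / \<theta>)) at_top"
    by (rule tendsto_powr[OF _ tendsto_const]) (use w in \<open>simp add: add_pos_pos less_imp_neq[THEN not_sym]\<close>)
  then have "((\<lambda>t. (R t powr (- \<theta>)) powr (- 1 / \<theta>)) \<longlongrightarrow> (1 + w powr (- \<theta>)) powr (- 1 / \<theta>)) at_top"
    by simp
  then show ?thesis
    unfolding R_def[symmetric]
  proof (rule Lim_transform_eventually)
    show "eventually (\<lambda>t. (R t powr (- \<theta>)) powr (- 1 / \<theta>) = R t) at_top"
      using eventually_ge_at_top[of 0] by eventually_elim (rule root_powr[OF R_pos])
  qed
qed

lemma cond_laplace_limit: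
  assumes w: "0 \<le> w"
  shows "((\<lambda>t. LINT \<omega>|uniform_measure M (survival_event M Z t).
             exp (- w * real (Z t \<omega>) / bp_cond_mean M Z t))
    \<longlongrightarrow> (if w = 0 then 1 else 1 - (1 + w powr (- \<theta>)) powr (- 1 / \<theta>))) at_top"
proof -
  define L where "L t = 1 - (1 - pgf (K 0 t 1) (exp (- (w / (mean_fn t / surv t))))) / surv t" for t
  have "(L \<longlongrightarrow> (if w = 0 then 1 else 1 - (1 + w powr (- \<theta>)) powr (- 1 / \<theta>))) at_top"
  proof (cases "w = 0")
    case True
    then show ?thesis by (simp add: L_def [abs_def] pgf_at_1)
  next
    case False
    then show ?thesis
      unfolding L_def [abs_def] using tendsto_diff[OF tendsto_const[of 1] laplace_limit[of w]] w by simp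
  qed
  then show ?thesis
  proof (rule Lim_transform_eventually)
    show "eventually (\<lambda>t. L t = (LINT \<omega>|uniform_measure M (survival_event M Z t).
             exp (- w * real (Z t \<omega>) / bp_cond_mean M Z t))) at_top"
      using eventually_ge_at_top[of 0]
    proof eventually_elim
      case (elim t)
      have "0 \<le> w / (mean_fn t / surv t)"
        using w mean_fn_pos[of t] surv_pos[OF elim] by (simp add: less_imp_le)
      from cond_laplace_eq[OF elim this] show ?case
        by (simp add: L_def bp_cond_mean_eq[OF elim] mult_ac)
    qed
  qed
qed

end

end
theorem theorem2p5:
  fixes M :: "'w measure" and \<theta> :: real and lam a :: "real \<Rightarrow> real"
    and p :: "real \<Rightarrow> nat pmf" and K :: "real \<Rightarrow> real \<Rightarrow> nat \<Rightarrow> nat pmf"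
    and Z :: "real \<Rightarrow> 'w \<Rightarrow> nat"
  assumes "theta_positive_bpve M \<theta> lam a p K Z"
  shows "(bp_critical M Z \<longleftrightarrow>
            bp_V_lim M Z \<theta> lam = \<infinity> \<and>
            filterlim (\<lambda>t. bp_mean M Z t powr \<theta> * bp_V M Z \<theta> lam t) at_top at_top)
         \<and>
         (bp_critical M Z \<longrightarrow>
            (\<lambda>t. measure M (survival_event M Z t))
              \<sim>[at_top] (\<lambda>t. bp_V M Z \<theta> lam t powr (- 1 / \<theta>)) \<and>
            bp_cond_mean M Z
              \<sim>[at_top] (\<lambda>t. bp_mean M Z t * bp_V M Z \<theta> lam t powr (1 / \<theta>)) \<and>
            (\<forall>w::real. w \<ge> 0 \<longrightarrow>
              ((\<lambda>t. LINT \<omega>|uniform_measure M (survival_event M Z t).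
                      exp (- w * real (Z t \<omega>) / bp_cond_mean M Z t))
                \<longlongrightarrow> (if w = 0 then 1 else 1 - (1 + w powr (- \<theta>)) powr (- 1 / \<theta>))) at_top))"
proof -
  interpret theta_positive_bpve M \<theta> lam a p K Z by fact
  have mean_V: "filterlim (\<lambda>t. bp_mean M Z t powr \<theta> * bp_V M Z \<theta> lam t) at_top at_top
      \<longleftrightarrow> filterlim (\<lambda>t. mean_fn t powr \<theta> * V t) at_top at_top"
    by (rule filterlim_cong_nonneg) (simp add: bp_mean_eq bp_V_eq)
  have iff: "bp_critical M Z \<longleftrightarrow> bp_V_lim M Z \<theta> lam = \<infinity> \<and>
      filterlim (\<lambda>t. bp_mean M Z t powr \<theta> * bp_V M Z \<theta> lam t) at_top at_top"
    unfolding mean_V bp_V_lim_infinite_iff by (rule critical_iff)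
  show ?thesis
  proof (intro conjI impI allI)
    assume "bp_critical M Z"
    then have V: "filterlim V at_top at_top" "filterlim (\<lambda>t. mean_fn t powr \<theta> * V t) at_top at_top"
      by (auto simp: critical_iff)
    show "(\<lambda>t. measure M (survival_event M Z t)) \<sim>[at_top] (\<lambda>t. bp_V M Z \<theta> lam t powr (- 1 / \<theta>))"
      by (rule asymp_equivI', rule Lim_transform_eventually[OF surv_asymptotics[OF V]])
        (rule eventually_at_top_nonnegI, simp add: prob_survival bp_V_eq)
    show "bp_cond_mean M Z \<sim>[at_top] (\<lambda>t. bp_mean M Z t * bp_V M Z \<theta> lam t powr (1 / \<theta>))"
      by (rule asymp_equivI', rule Lim_transform_eventually[OF cond_mean_asymptotics[OF V]])
        (rule eventually_at_top_nonnegI, simp add: bp_cond_mean_eq bp_mean_eq bp_V_eq)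
    show "((\<lambda>t. LINT \<omega>|uniform_measure M (survival_event M Z t).
              exp (- w * real (Z t \<omega>) / bp_cond_mean M Z t))
        \<longlongrightarrow> (if w = 0 then 1 else 1 - (1 + w powr (- \<theta>)) powr (- 1 / \<theta>))) at_top"
      if "w \<ge> 0" for w
      by (rule cond_laplace_limit[OF V that])
  qed (use iff in auto)
qed

end
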